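(* Let $n$ be a positive integer. For any partitions $\alpha$ and $\beta$ of $n$ with no part of size $1$, we have $$H_n - 3 < \mathbb{E}[C_{\alpha,\beta}] \leq H_n + 1.$$
   Context: $\mathfrak{S}_n$ is the symmetric group on $[n]=\{1,\dots,n\}$. A partition of $n$ is a weakly decreasing list of positive integers (its parts) with sum $n$. For a partition $\alpha$ of $n$, $C_\alpha\subseteq\mathfrak{S}_n$ is the conjugacy class of permutations of cycle type $\alpha$. For partitions $\alpha,\beta$ of $n$, $C_{\alpha,\beta}$ (with two subscripts) denotes the random variable equal to the number of cycles (fixed points included as cycles) of the product $\sigma\omega$, where $\sigma$ and $\omega$ are chosen independently and uniformly at random from $C_\alpha$ and $C_\beta$ respectively. Thus $\mathbb{E}[C_{\alpha,\beta}]=\frac{1}{|C_\alpha||C_\beta|}\sum_{\sigma\in C_\alpha,\ \omega\in C_\beta}c(\sigma\omega)$, where $c(\cdot)$ is the number of cycles. $H_n=\sum_{i=1}^n \frac1i$ is the $n$-th harmonic number. *)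

theory Defs
  imports "HOL-Probability.Probability" "HOL-Combinatorics.Orbits"
begin

definition partition_of :: "nat \<Rightarrow> nat list \<Rightarrow> bool" where
  "partition_of n \<alpha> \<longleftrightarrow> sorted_wrt (\<ge>) \<alpha> \<and> (\<forall>a\<in>set \<alpha>. 0 < a) \<and> sum_list \<alpha> = n"

(* The cycles of a permutation of [n], as sets of points; fixed points give singletons. *)
definition cycles :: "nat \<Rightarrow> (nat \<Rightarrow> nat) \<Rightarrow> nat set set" where
  "cycles n \<sigma> = orbit \<sigma> ` {1..n}"

definition cycle_type :: "nat \<Rightarrow> (nat \<Rightarrow> nat) \<Rightarrow> nat list" where
  "cycle_type n \<sigma> = rev (sorted_list_of_multiset (image_mset card (mset_set (cycles n \<sigma>))))"

definition conj_class :: "nat \<Rightarrow> nat list \<Rightarrow> (nat \<Rightarrow> nat) set" where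
  "conj_class n \<alpha> = {\<sigma>. \<sigma> permutes {1..n} \<and> cycle_type n \<sigma> = \<alpha>}"

(* The law of the number of cycles of the product of two independent uniform elements
   of the classes; pmf_of_set is meaningful because the class of a partition of n is
   finite and nonempty. *)
definition cycle_count_pmf :: "nat \<Rightarrow> nat list \<Rightarrow> nat list \<Rightarrow> nat pmf" where
  "cycle_count_pmf n \<alpha> \<beta> =
     map_pmf (\<lambda>(\<sigma>, \<omega>). card (cycles n (\<sigma> \<circ> \<omega>)))
       (pair_pmf (pmf_of_set (conj_class n \<alpha>)) (pmf_of_set (conj_class n \<beta>)))"

lemma finite_conj_class: "finite (conj_class n \<alpha>)"
  unfolding conj_class_def
  by (rule finite_subset[OF _ finite_permutations[of "{1..n}"]]) auto

lemma ex_permutation_cycle_lengths: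
  assumes "\<forall>a\<in>set \<alpha>. 0 < a"
  shows "\<exists>\<sigma>. \<sigma> permutes {1..sum_list \<alpha>} \<and>
           image_mset card (mset_set (cycles (sum_list \<alpha>) \<sigma>)) = mset \<alpha>"
  using assms
proof (induction \<alpha>)
  case Nil
  show ?case by (intro exI[of _ id]) (auto simp: cycles_def permutes_id)
next
  case (Cons a \<alpha>)
  define m where "m = sum_list \<alpha>"
  have a: "0 < a" using Cons.prems by simp
  from Cons obtain \<sigma> where \<sigma>: "\<sigma> permutes {1..m}"
    and type: "image_mset card (mset_set (cycles m \<sigma>)) = mset \<alpha>"
    by (auto simp: m_def)
  define \<tau> where "\<tau> x = (if x \<le> m then \<sigma> x else if x < m + a then x + 1
                          else if x = m + a then m + 1 else x)" for x
  have \<sigma>_le: "\<sigma> x \<in> {1..m} \<longleftrightarrow> x \<in> {1..m}" for x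
    using permutes_in_image[OF \<sigma>] by blast
  have \<sigma>_0: "\<sigma> 0 = 0" using permutes_not_in[OF \<sigma>, of 0] by simp
  have \<sigma>_le': "\<sigma> x \<le> m" if "x \<le> m" for x
    using \<sigma>_le[of x] \<sigma>_0 that by (cases "x = 0") auto
  have inj: "inj \<sigma>" using permutes_inj[OF \<sigma>] .
  have perm: "\<tau> permutes {1..m + a}"
  proof (rule bij_imp_permutes)
    have "inj_on \<tau> {1..m + a}"
    proof (rule inj_onI)
      fix x y assume "x \<in> {1..m + a}" "y \<in> {1..m + a}" "\<tau> x = \<tau> y"
      then show "x = y"
        using injD[OF inj, of x y] \<sigma>_le'[of x] \<sigma>_le'[of y]
        by (auto simp: \<tau>_def split: if_splits)
    qed
    moreover have "\<tau> ` {1..m + a} \<subseteq> {1..m + a}"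
    proof (rule image_subsetI)
      fix x assume "x \<in> {1..m + a}"
      then show "\<tau> x \<in> {1..m + a}"
        using a \<sigma>_le[of x] by (cases "x \<le> m") (auto simp: \<tau>_def)
    qed
    ultimately show "bij_betw \<tau> {1..m + a} {1..m + a}"
      by (simp add: bij_betw_def endo_inj_surj)
  next
    fix x assume "x \<notin> {1..m + a}"
    then show "\<tau> x = x" using \<sigma>_0 by (cases "x = 0") (auto simp: \<tau>_def)
  qed
  have old: "orbit \<tau> x = orbit \<sigma> x" if "x \<in> {1..m}" for x
  proof -
    have "(\<tau> ^^ k) x = (\<sigma> ^^ k) x \<and> (\<sigma> ^^ k) x \<in> {1..m}" for k
      using that \<sigma>_le by (induction k) (auto simp: \<tau>_def)
    then show ?thesis by (simp add: orbit_altdef)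
  qed
  have new: "orbit \<tau> x = {m + 1..m + a}" if x: "x \<in> {m + 1..m + a}" for x
  proof
    show "orbit \<tau> x \<subseteq> {m + 1..m + a}"
    proof
      fix y assume "y \<in> orbit \<tau> x"
      then show "y \<in> {m + 1..m + a}"
        using x a by induction (auto simp: \<tau>_def)
    qed
    have up: "m + a \<in> orbit \<tau> x"
    proof -
      have "x \<in> orbit \<tau> x"
        by (rule permutation_self_in_orbit) (use perm in \<open>auto simp: permutation_permutes\<close>)
      moreover have "x + k \<le> m + a \<Longrightarrow> x \<in> orbit \<tau> x \<Longrightarrow> x + k \<in> orbit \<tau> x" for k
      proof (induction k)
        case (Suc k)
        then have "\<tau> (x + k) \<in> orbit \<tau> x" by (intro orbit.step) auto
        moreover have "\<tau> (x + k) = x + Suc k" using Suc.prems x by (simp add: \<tau>_def)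
        ultimately show ?case by simp
      qed simp
      ultimately show ?thesis using x by (metis atLeastAtMost_iff le_Suc_ex order_refl)
    qed
    have "m + 1 + k \<in> orbit \<tau> x" if "k < a" for k
      using that
    proof (induction k)
      case 0
      have "\<tau> (m + a) \<in> orbit \<tau> x" using up by (rule orbit.step)
      moreover have "\<tau> (m + a) = m + 1" using a by (simp add: \<tau>_def)
      ultimately show ?case by simp
    next
      case (Suc k)
      then have "\<tau> (m + 1 + k) \<in> orbit \<tau> x" by (intro orbit.step) auto
      moreover have "\<tau> (m + 1 + k) = m + 1 + Suc k" using Suc.prems by (simp add: \<tau>_def)
      ultimately show ?case by simp
    qed
    then show "{m + 1..m + a} \<subseteq> orbit \<tau> x"
    proof (intro subsetI)
      fix y assume "y \<in> {m + 1..m + a}"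
      then have "y = m + 1 + (y - (m + 1))" "y - (m + 1) < a" by auto
      then show "y \<in> orbit \<tau> x" using \<open>\<And>k. k < a \<Longrightarrow> m + 1 + k \<in> orbit \<tau> x\<close> by metis
    qed
  qed
  have split: "{1..m + a} = {1..m} \<union> {m + 1..m + a}" by auto
  have "orbit \<tau> ` {m + 1..m + a} = {{m + 1..m + a}}"
  proof -
    have "orbit \<tau> ` {m + 1..m + a} = (\<lambda>_. {m + 1..m + a}) ` {m + 1..m + a}"
      using new by (intro image_cong) auto
    then show ?thesis using a by (simp add: image_constant_conv)
  qed
  then have cyc: "cycles (m + a) \<tau> = insert {m + 1..m + a} (cycles m \<sigma>)"
    unfolding cycles_def split image_Un using old by auto
  have "{m + 1..m + a} \<notin> cycles m \<sigma>"
  proof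
    assume "{m + 1..m + a} \<in> cycles m \<sigma>"
    then obtain x where "x \<in> {1..m}" "{m + 1..m + a} = orbit \<sigma> x" by (auto simp: cycles_def)
    then have "\<sigma> x \<in> {m + 1..m + a}" using orbit.base[of \<sigma> x] by simp
    then show False using \<sigma>_le'[of x] \<open>x \<in> {1..m}\<close> by auto
  qed
  moreover have "finite (cycles m \<sigma>)" by (simp add: cycles_def)
  ultimately have "image_mset card (mset_set (cycles (m + a) \<tau>)) = mset (a # \<alpha>)"
    using type by (simp add: cyc)
  then show ?case using perm by (auto simp: m_def add.commute)
qed

lemma conj_class_nonempty:
  assumes "partition_of n \<alpha>"
  shows "conj_class n \<alpha> \<noteq> {}"
proof -
  obtain \<sigma> where \<sigma>: "\<sigma> permutes {1..n}" "image_mset card (mset_set (cycles n \<sigma>)) = mset \<alpha>"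
    using ex_permutation_cycle_lengths[of \<alpha>] assms by (auto simp: partition_of_def)
  have "sorted (rev \<alpha>)"
    using assms by (simp add: partition_of_def sorted_wrt_rev)
  then have "sorted_list_of_multiset (mset \<alpha>) = rev \<alpha>"
    by (metis mset_rev sorted_list_of_multiset_mset sorted_sort_id)
  then have "cycle_type n \<sigma> = \<alpha>"
    using \<sigma>(2) by (simp add: cycle_type_def)
  then show ?thesis using \<sigma>(1) by (auto simp: conj_class_def)
qed

lemma expectation_cycle_count_pmf:
  assumes "partition_of n \<alpha>" "partition_of n \<beta>"
  shows "measure_pmf.expectation (cycle_count_pmf n \<alpha> \<beta>) real =
    (\<Sum>\<sigma>\<in>conj_class n \<alpha>. \<Sum>\<omega>\<in>conj_class n \<beta>. real (card (cycles n (\<sigma> \<circ> \<omega>))))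
      / (real (card (conj_class n \<alpha>)) * real (card (conj_class n \<beta>)))"
proof -
  let ?A = "conj_class n \<alpha>" and ?B = "conj_class n \<beta>"
  have ne: "?A \<noteq> {}" "?B \<noteq> {}" and fin: "finite ?A" "finite ?B"
    using assms by (auto simp: conj_class_nonempty finite_conj_class)
  have "pair_pmf (pmf_of_set ?A) (pmf_of_set ?B) = pmf_of_set (?A \<times> ?B)"
  proof (rule pmf_eqI)
    fix p
    have "?A \<times> ?B \<noteq> {}" "finite (?A \<times> ?B)" using ne fin by auto
    then show "pmf (pair_pmf (pmf_of_set ?A) (pmf_of_set ?B)) p = pmf (pmf_of_set (?A \<times> ?B)) p"
      using pmf_of_set[OF ne(1) fin(1)] pmf_of_set[OF ne(2) fin(2)]
      by (cases p) (simp add: pmf_pair pmf_of_set indicator_def card_cartesian_product)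
  qed
  then show ?thesis
    using ne fin
    by (simp add: cycle_count_pmf_def integral_pmf_of_set sum.cartesian_product
        case_prod_unfold card_cartesian_product)
qed

end

theory Submission
  imports Defs
begin

text \<open>
  Conjugating \<open>\<omega>\<close> by a uniformly random \<open>\<pi>\<close> does not change its law, so it suffices
  to bound the mean of the number of cycles of \<open>\<sigma> \<circ> inv \<pi> \<circ> \<omega> \<circ> \<pi>\<close> over all \<open>\<pi>\<close>, for fixed \<open>\<sigma>\<close>
  and \<open>\<omega>\<close> without fixed points. Let \<open>\<sigma>\<close> act on a set \<open>X\<close> and \<open>\<omega>\<close> on a disjoint copy \<open>Y\<close>, and let \<open>P\<close> be
  the permutation of \<open>X \<union> Y\<close> which they form together. Then \<open>\<pi>\<close> becomes a perfect matching \<open>\<tau>\<close> between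
  \<open>X\<close> and \<open>Y\<close>, and the cycles to be counted are those of \<open>P \<circ> \<tau>\<close>.

  The matching is revealed pair by pair. When the partner \<open>y\<close> of a point \<open>x\<close> is known, both points
  can be removed, and what remains is a problem of the same kind with one
  pair less (\<open>mean_cycles_step\<close>): the cycle of \<open>x\<close> and the cycle of \<open>y\<close> are merged, or their common
  cycle is split, and \<open>x\<close> and \<open>y\<close> are cut out. A cycle of \<open>P \<circ> \<tau>\<close> is completed if \<open>x\<close> and \<open>y\<close> were
  neighbours in a cycle, or if both were fixed points. As \<open>y\<close> is uniform, the mean number of cycles
  completed by a step with \<open>k\<close> pairs left is \<open>1 / k\<close> whenever exactly one of the two neighbours of \<open>x\<close>
  lies in the other set. The mean does not depend on the order in which pairs are revealed, and the
  proof chooses the next point so that this situation is the rule. Then the total is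
  \<open>1 / n + \<dots> + 1 / 1\<close>, up to corrections. All states that occur have at most one cycle that meets
  both \<open>X\<close> and \<open>Y\<close>, and this mixed cycle consists of one run of points in \<open>X\<close> and one run in \<open>Y\<close>. The
  last point of a run of length at least two has the desired property. Corrections come from states
  without a mixed cycle (called pure), where a step completes nothing unless it matches two fixed
  points, and from runs of length one.

  For the upper bound (\<open>mean_cycles_upper\<close>) only two situations are dangerous. If both runs have length
  one, a step completes \<open>2 / k\<close> cycles in the mean, but then the next state is pure, so the surplus
  is paid back at once unless \<open>k = 1\<close>; this gives the summand one. The other danger is to accumulate
  fixed points on both sides. It is avoided by revealing a fixed point as soon as it appears, which
  never creates more than one new fixed point.

  For the lower bound (\<open>mean_cycles_lower\<close>) only points of \<open>X\<close> are revealed: in a mixed state the last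
  point of the run in \<open>X\<close>, and in a pure state a point of an \<open>X\<close>-cycle of length at least three, as
  long as there is one. At most one fixed point of \<open>X\<close> exists at a time, and it is revealed at once.
  A mixed state whose run in \<open>X\<close> is longer than one becomes pure with probability \<open>1 / k\<close>, and a step
  in a pure state falls at most \<open>1 / k\<close> behind, so that these losses are summable. A run of length one
  always leads to a pure state, but it completes \<open>2 / k\<close> cycles, which makes up for that. However, a
  pure state stays pure if the chosen partner is one of the \<open>v\<close> fixed points in \<open>Y\<close>, so \<open>v\<close> has to be
  controlled. In most steps a new fixed point appears with probability of order \<open>1 / k\<close>, each old one
  is hit with probability \<open>1 / k\<close>, and therefore \<open>v\<close> stays bounded in the mean; this is expressed by a
  potential which is linear in \<open>v\<close>. When \<open>X\<close> has only cycles of length two, fixed points can persist,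
  but then they do no harm: revealing one such cycle, which takes two steps, completes
  \<open>2 / k + (v - 1) * (v - 2) / (k * (k - 1))\<close> cycles in the mean, which is at least \<open>2 / k\<close> for
  every \<open>v\<close> (\<open>mean_cycles_lower_involution\<close>).
\<close>

section \<open>Cutting a point out of a permutation\<close>

abbreviation swap :: "'a \<Rightarrow> 'a \<Rightarrow> 'a \<Rightarrow> 'a" where
  "swap \<equiv> Transposition.transpose"

definition ncyc :: "('a \<Rightarrow> 'a) \<Rightarrow> 'a set \<Rightarrow> nat" where
  "ncyc f Z = card (orbit f ` Z)"

definition del :: "'a \<Rightarrow> ('a \<Rightarrow> 'a) \<Rightarrow> 'a \<Rightarrow> 'a" where
  "del x f z = (if z = x then x else if f z = x then f x else f z)"

lemma del_conv_transpose:
  assumes "inj f"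
  shows "del x f = swap x (f x) \<circ> f"
proof
  fix z
  show "del x f z = (swap x (f x) \<circ> f) z"
    using assms by (auto simp: del_def Transposition.transpose_def inj_eq)
qed

lemma del_permutes:
  assumes "f permutes Z" "x \<in> Z"
  shows "del x f permutes (Z - {x})"
proof -
  have "del x f = swap x (f x) \<circ> f"
    using assms by (intro del_conv_transpose permutes_inj)
  moreover have "swap x (f x) \<circ> f permutes Z"
    using assms by (intro permutes_compose permutes_swap_id) (auto simp: permutes_in_image)
  ultimately have "del x f permutes Z" by simp
  then show ?thesis
    by (rule permutes_superset) (auto simp: del_def)
qed

lemma orbit_del:
  assumes f: "f permutes Z" and z: "z \<noteq> x"
  shows "orbit (del x f) z = orbit f z - {x}"
proof
  have inj: "f a = f b \<longleftrightarrow> a = b" for a b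
    using permutes_inj[OF f] by (simp add: inj_eq)
  show "orbit (del x f) z \<subseteq> orbit f z - {x}"
  proof
    fix y assume "y \<in> orbit (del x f) z"
    then show "y \<in> orbit f z - {x}"
    proof induction
      case base
      then show ?case using z inj[of z x] orbit.base[of f z] orbit.step[of x f z]
        by (auto simp: del_def)
    next
      case (step y)
      then show ?case using inj[of y x] orbit.step[of y f z] orbit.step[of x f z]
        by (auto simp: del_def)
    qed
  qed
  show "orbit f z - {x} \<subseteq> orbit (del x f) z"
  proof
    fix y assume y: "y \<in> orbit f z - {x}"
    have "y \<in> orbit f z \<Longrightarrow> (if y = x then f x else y) \<in> orbit (del x f) z" for y
    proof (induction rule: orbit.induct)
      case base
      then show ?case using z orbit.base[of "del x f" z]
        by (auto simp: del_def[of x f z] split: if_splits)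
    next
      case (step y)
      then show ?case using orbit.step[of y "del x f" z]
        by (auto simp: del_def[of x f y] split: if_splits)
    qed
    from this[of y] y show "y \<in> orbit (del x f) z" by auto
  qed
qed

lemma ncyc_del:
  assumes f: "f permutes Z" and Z: "finite Z" "x \<in> Z"
  shows "ncyc f Z = ncyc (del x f) (Z - {x}) + of_bool (f x = x)"
proof -
  have perm: "permutation f" using f Z by (auto simp: permutation_permutes)
  have self: "z \<in> orbit f z" for z by (rule permutation_self_in_orbit[OF perm])
  have eq: "orbit f z = orbit f z'" if "z \<in> orbit f z'" for z z'
    by (rule orbit_cyclic_eq3[OF cyclic_on_orbit'[OF perm] that])
  have inj: "inj_on (\<lambda>C. C - {x}) (orbit f ` (Z - {x}))"
  proof (rule inj_onI)
    fix C C' assume "C \<in> orbit f ` (Z - {x})" "C' \<in> orbit f ` (Z - {x})" "C - {x} = C' - {x}"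
    then obtain z z' where z: "C = orbit f z" "C' = orbit f z'" "z \<noteq> x"
      and "orbit f z - {x} = orbit f z' - {x}" by blast
    then have "z \<in> orbit f z'" using self[of z] by blast
    then show "C = C'" unfolding z by (rule eq)
  qed
  have "orbit (del x f) ` (Z - {x}) = (\<lambda>C. C - {x}) ` orbit f ` (Z - {x})"
    using orbit_del[OF f] by (auto simp: image_image)
  then have card: "ncyc (del x f) (Z - {x}) = card (orbit f ` (Z - {x}))"
    unfolding ncyc_def using card_image[OF inj] by simp
  have Zx: "orbit f ` Z = insert (orbit f x) (orbit f ` (Z - {x}))"
    using Z by auto
  show ?thesis
  proof (cases "f x = x")
    case True
    then have "orbit f x = {x}" by (simp add: orbit_eq_singleton_iff)
    moreover have "{x} \<notin> orbit f ` (Z - {x})" using self by auto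
    ultimately show ?thesis using True card Zx Z by (simp add: ncyc_def)
  next
    case False
    have "orbit f x = orbit f (f x)"
      using eq[of "f x" x] orbit.base[of f x] by simp
    moreover have "f x \<in> Z - {x}" using False f Z by (auto simp: permutes_in_image)
    ultimately have "orbit f x \<in> orbit f ` (Z - {x})" by auto
    then show ?thesis using False card Zx by (simp add: ncyc_def insert_absorb)
  qed
qed

section \<open>Matchings and the mean number of cycles\<close>

text \<open>
  A matching between \<open>X\<close> and \<open>Y\<close> is represented by the involution that swaps the partners; this
  makes the notion symmetric in \<open>X\<close> and \<open>Y\<close>.
\<close>

definition matchings :: "'a set \<Rightarrow> 'a set \<Rightarrow> ('a \<Rightarrow> 'a) set" where
  "matchings X Y = {\<tau>. \<tau> permutes (X \<union> Y) \<and> (\<forall>x\<in>X. \<tau> x \<in> Y) \<and> (\<forall>y\<in>Y. \<tau> y \<in> X)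
     \<and> (\<forall>z. \<tau> (\<tau> z) = z)}"

lemma matchings_commute: "matchings X Y = matchings Y X"
  by (auto simp: matchings_def Un_commute)

lemma finite_matchings: "finite X \<Longrightarrow> finite Y \<Longrightarrow> finite (matchings X Y)"
  by (rule finite_subset[OF _ finite_permutations[of "X \<union> Y"]]) (auto simp: matchings_def)

lemma matchings_fixes: "\<tau> \<in> matchings X Y \<Longrightarrow> z \<notin> X \<union> Y \<Longrightarrow> \<tau> z = z"
  by (auto simp: matchings_def permutes_not_in)

lemma matching_extend:
  assumes "\<tau> \<in> matchings (X - {x}) (Y - {y})" "x \<in> X" "y \<in> Y" "X \<inter> Y = {}"
  shows "\<tau> \<circ> swap x y \<in> matchings X Y" "(\<tau> \<circ> swap x y) x = y"
proof -
  have fx: "\<tau> x = x" "\<tau> y = y" using matchings_fixes[OF assms(1)] assms by auto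
  have inv: "\<tau> (\<tau> z) = z" for z using assms(1) by (auto simp: matchings_def)
  have ne: "\<tau> z = x \<longleftrightarrow> z = x" "\<tau> z = y \<longleftrightarrow> z = y" for z using fx(1) fx(2) inv by (metis (full_types))+
  have per: "\<tau> permutes (X \<union> Y)"
    using assms(1) by (auto simp: matchings_def intro: permutes_subset)
  show "(\<tau> \<circ> swap x y) x = y" using fx by simp
  have "\<tau> \<circ> swap x y permutes (X \<union> Y)"
    using per assms by (intro permutes_compose permutes_swap_id) auto
  moreover have "(\<tau> \<circ> swap x y) z \<in> Y" if "z \<in> X" for z
    using assms that fx(2) unfolding matchings_def comp_def Transposition.transpose_def by auto
  moreover have "(\<tau> \<circ> swap x y) z \<in> X" if "z \<in> Y" for z
    using assms that fx(1) unfolding matchings_def comp_def Transposition.transpose_def by auto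
  moreover have "(\<tau> \<circ> swap x y) ((\<tau> \<circ> swap x y) z) = z" for z
    using fx inv[of z] ne[of z] by (cases "z = x"; cases "z = y") auto
  ultimately show "\<tau> \<circ> swap x y \<in> matchings X Y"
    unfolding matchings_def by blast
qed

lemma matching_restrict:
  assumes "\<tau> \<in> matchings X Y" "\<tau> x = y" "x \<in> X" "y \<in> Y" "X \<inter> Y = {}"
  shows "\<tau> \<circ> swap x y \<in> matchings (X - {x}) (Y - {y})"
proof -
  have inv: "\<tau> (\<tau> z) = z" for z using assms(1) by (auto simp: matchings_def)
  have yx: "\<tau> y = x" using inv[of x] assms by simp
  have ne: "\<tau> z = x \<longleftrightarrow> z = y" "\<tau> z = y \<longleftrightarrow> z = x" for z using assms(2) yx inv by metis+
  have xy: "x \<noteq> y" using assms by auto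
  have "\<tau> permutes (X \<union> Y)" using assms(1) by (auto simp: matchings_def)
  then have "\<tau> \<circ> swap x y permutes (X \<union> Y)"
    using assms by (intro permutes_compose permutes_swap_id) auto
  then have "\<tau> \<circ> swap x y permutes ((X - {x}) \<union> (Y - {y}))"
    by (rule permutes_superset) (use assms yx in auto)
  moreover have "(\<tau> \<circ> swap x y) z \<in> Y - {y}" if "z \<in> X - {x}" for z
    using assms that ne[of z] unfolding matchings_def by auto
  moreover have "(\<tau> \<circ> swap x y) z \<in> X - {x}" if "z \<in> Y - {y}" for z
    using assms that ne[of z] unfolding matchings_def by auto
  moreover have "(\<tau> \<circ> swap x y) ((\<tau> \<circ> swap x y) z) = z" for z
    using assms(2) yx xy inv[of z] ne[of z] by (cases "z = x"; cases "z = y") auto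
  ultimately show ?thesis
    unfolding matchings_def by blast
qed

text \<open>A matching amounts to a partner of \<open>x\<close> and a matching of the remaining points.\<close>

lemma sum_matchings:
  fixes g :: "('a \<Rightarrow> 'a) \<Rightarrow> 'b::comm_monoid_add"
  assumes "finite X" "finite Y" "X \<inter> Y = {}" "x \<in> X"
  shows "sum g (matchings X Y) =
    (\<Sum>y\<in>Y. \<Sum>\<tau>\<in>matchings (X - {x}) (Y - {y}). g (\<tau> \<circ> swap x y))"
proof -
  have "sum g (matchings X Y) = (\<Sum>y\<in>Y. sum g {\<tau> \<in> matchings X Y. \<tau> x = y})"
    using assms by (intro sum.group[symmetric] finite_matchings) (auto simp: matchings_def)
  also have "\<dots> = (\<Sum>y\<in>Y. \<Sum>\<tau>\<in>matchings (X - {x}) (Y - {y}). g (\<tau> \<circ> swap x y))"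
  proof (rule sum.cong[OF refl])
    fix y assume y: "y \<in> Y"
    have tt: "f \<circ> swap x y \<circ> swap x y = f" for f :: "'a \<Rightarrow> 'a"
      by (simp add: comp_assoc)
    show "sum g {\<tau> \<in> matchings X Y. \<tau> x = y} =
      (\<Sum>\<tau>\<in>matchings (X - {x}) (Y - {y}). g (\<tau> \<circ> swap x y))"
    proof (rule sum.reindex_bij_witness[of _ "\<lambda>\<tau>. \<tau> \<circ> swap x y" "\<lambda>\<tau>. \<tau> \<circ> swap x y"])
      fix \<tau> assume "\<tau> \<in> {\<tau> \<in> matchings X Y. \<tau> x = y}"
      then show "\<tau> \<circ> swap x y \<in> matchings (X - {x}) (Y - {y})"
        using matching_restrict[of \<tau> X Y x y] assms y by blast
    next
      fix \<tau> assume "\<tau> \<in> matchings (X - {x}) (Y - {y})"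
      then show "\<tau> \<circ> swap x y \<in> {\<tau> \<in> matchings X Y. \<tau> x = y}"
        using matching_extend[of \<tau> X x Y y] assms y by blast
    qed (simp_all only: tt)
  qed
  finally show ?thesis .
qed

lemma matchings_empty: "matchings {} {} = {id}"
  by (auto simp: matchings_def permutes_empty)

lemma card_matchings:
  assumes "finite X" "finite Y" "X \<inter> Y = {}" "card X = card Y"
  shows "card (matchings X Y) = fact (card X)"
  using assms
proof (induction "card X" arbitrary: X Y)
  case 0
  then show ?case by (simp add: matchings_empty)
next
  case (Suc k)
  then obtain x where x: "x \<in> X" by (metis card.empty equals0I nat.distinct(1))
  have card: "card X = Suc k" "card Y = Suc k" using Suc.hyps(2) Suc.prems by simp_all
  have "card (matchings X Y) = (\<Sum>\<tau>\<in>matchings X Y. 1)" by simp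
  also have "\<dots> = (\<Sum>y\<in>Y. card (matchings (X - {x}) (Y - {y})))"
    using Suc.prems x by (subst sum_matchings[of X Y x]) auto
  also have "\<dots> = (\<Sum>y\<in>Y. fact k)"
  proof (rule sum.cong[OF refl])
    fix y assume y: "y \<in> Y"
    have "card (X - {x}) = k" "card (Y - {y}) = k"
      using card x y by simp_all
    moreover have "(X - {x}) \<inter> (Y - {y}) = {}" using Suc.prems by auto
    ultimately show "card (matchings (X - {x}) (Y - {y})) = fact k"
      using Suc.hyps(1)[of "X - {x}" "Y - {y}"] Suc.prems by simp
  qed
  also have "\<dots> = fact (card X)" using card by simp
  finally show ?case .
qed

definition mean_cycles :: "('a \<Rightarrow> 'a) \<Rightarrow> 'a set \<Rightarrow> 'a set \<Rightarrow> real" where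
  "mean_cycles P X Y = (\<Sum>\<tau>\<in>matchings X Y. real (ncyc (P \<circ> \<tau>) (X \<union> Y))) / fact (card X)"

text \<open>
  If \<open>x\<close> is matched with \<open>y\<close>, then \<open>P \<circ> \<tau>\<close> is the composition of \<open>P \<circ> swap x y\<close> with a matching of the
  other points, from which \<open>x\<close> and \<open>y\<close> can be cut out.
\<close>

definition glue :: "'a \<Rightarrow> 'a \<Rightarrow> ('a \<Rightarrow> 'a) \<Rightarrow> 'a \<Rightarrow> 'a" where
  "glue x y P = del x (del y (P \<circ> swap x y))"

text \<open>The number of cycles of \<open>P \<circ> swap x y\<close> inside \<open>{x, y}\<close>, which are lost when both points are cut out.\<close>

definition closings :: "'a \<Rightarrow> 'a \<Rightarrow> ('a \<Rightarrow> 'a) \<Rightarrow> nat" where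
  "closings x y P = of_bool (P x = y) + of_bool (P y = x) + of_bool (P x = x \<and> P y = y)"

definition bicoloured :: "nat \<Rightarrow> ('a \<Rightarrow> 'a) \<Rightarrow> 'a set \<Rightarrow> 'a set \<Rightarrow> bool" where
  "bicoloured k P X Y \<longleftrightarrow> finite X \<and> finite Y \<and> X \<inter> Y = {} \<and> card X = k \<and> card Y = k \<and> P permutes (X \<union> Y)"

lemma bicoloured_commute: "bicoloured k P X Y \<Longrightarrow> bicoloured k P Y X"
  by (auto simp: bicoloured_def Un_commute)

lemma mean_cycles_commute: "bicoloured k P X Y \<Longrightarrow> mean_cycles P X Y = mean_cycles P Y X"
  by (simp add: mean_cycles_def bicoloured_def matchings_commute[of X] Un_commute[of X])

lemma glue_apply:
  assumes "inj P" "x \<noteq> y" "z \<noteq> x" "z \<noteq> y"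
  shows "glue x y P z = (if P z = y then if P x = x then P y else P x
    else if P z = x then if P y = y then P x else P y else P z)"
proof -
  have "P a = P b \<longleftrightarrow> a = b" for a b using assms by (simp add: inj_eq)
  note * = this[of z x] this[of z y] this[of x y]
  show ?thesis using assms * by (auto simp: glue_def del_def)
qed

lemma bicoloured_glue:
  assumes "bicoloured (Suc k) P X Y" "x \<in> X" "y \<in> Y"
  shows "bicoloured k (glue x y P) (X - {x}) (Y - {y})"
proof -
  have "P \<circ> swap x y permutes (X \<union> Y)"
    using assms by (intro permutes_compose permutes_swap_id) (auto simp: bicoloured_def)
  then have "glue x y P permutes (X \<union> Y - {y} - {x})"
    unfolding glue_def using assms by (intro del_permutes) (auto simp: bicoloured_def)
  moreover have "X \<union> Y - {y} - {x} = (X - {x}) \<union> (Y - {y})"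
    using assms by (auto simp: bicoloured_def)
  ultimately show ?thesis using assms by (auto simp: bicoloured_def)
qed

lemma del_comp_fixing:
  assumes "inj \<tau>" "\<tau> x = x"
  shows "del x (Q \<circ> \<tau>) = del x Q \<circ> \<tau>"
proof
  fix z
  have "\<tau> z = x \<longleftrightarrow> z = x" using assms by (metis injD)
  then show "del x (Q \<circ> \<tau>) z = (del x Q \<circ> \<tau>) z" using assms by (auto simp: del_def)
qed

lemma ncyc_glue:
  assumes a: "bicoloured k P X Y" "x \<in> X" "y \<in> Y" and \<tau>: "\<tau> \<in> matchings (X - {x}) (Y - {y})"
  shows "ncyc (P \<circ> (\<tau> \<circ> swap x y)) (X \<union> Y) =
    closings x y P + ncyc (glue x y P \<circ> \<tau>) ((X - {x}) \<union> (Y - {y}))"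
proof -
  define Q where "Q = P \<circ> swap x y"
  have xy: "x \<noteq> y" using a by (auto simp: bicoloured_def)
  have fx: "\<tau> x = x" "\<tau> y = y" using matchings_fixes[OF \<tau>] a by (auto simp: bicoloured_def)
  have \<tau>': "\<tau> permutes (X - {x}) \<union> (Y - {y})" using \<tau> by (auto simp: matchings_def)
  then have inj: "inj \<tau>" by (rule permutes_inj)
  have \<tau>_per: "\<tau> permutes X \<union> Y" using \<tau>' by (rule permutes_subset) auto
  have injP: "inj P" using a by (auto simp: bicoloured_def permutes_inj)
  have "swap x y \<circ> \<tau> = \<tau> \<circ> swap x y"
  proof
    fix z
    have "\<tau> z = x \<longleftrightarrow> z = x" "\<tau> z = y \<longleftrightarrow> z = y" using inj fx by (metis injD)+
    then show "(swap x y \<circ> \<tau>) z = (\<tau> \<circ> swap x y) z"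
      using fx by (auto simp: Transposition.transpose_def)
  qed
  then have eq: "P \<circ> (\<tau> \<circ> swap x y) = Q \<circ> \<tau>" by (simp add: Q_def comp_assoc)
  have Q: "Q permutes X \<union> Y"
    unfolding Q_def using a by (intro permutes_compose permutes_swap_id) (auto simp: bicoloured_def)
  have fin: "finite (X \<union> Y)" using a by (auto simp: bicoloured_def)
  have in_XY: "x \<in> X \<union> Y - {y}" "y \<in> X \<union> Y" using a xy by auto
  have 1: "ncyc (Q \<circ> \<tau>) (X \<union> Y) =
      ncyc (del y Q \<circ> \<tau>) (X \<union> Y - {y}) + of_bool (Q y = y)"
    using ncyc_del[OF permutes_compose[OF \<tau>_per Q] fin in_XY(2)]
    unfolding del_comp_fixing[OF inj fx(2)] comp_apply fx .
  have "del y Q \<circ> \<tau> permutes X \<union> Y - {y}"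
    by (intro permutes_compose[OF permutes_subset[OF \<tau>'] del_permutes[OF Q in_XY(2)]])
      (use a in \<open>auto simp: bicoloured_def\<close>)
  from ncyc_del[OF this _ in_XY(1)] fin
  have 2: "ncyc (del y Q \<circ> \<tau>) (X \<union> Y - {y}) =
      ncyc (del x (del y Q) \<circ> \<tau>) (X \<union> Y - {y} - {x}) + of_bool (del y Q x = x)"
    unfolding del_comp_fixing[OF inj fx(1)] comp_apply fx by blast
  have "P a = P b \<longleftrightarrow> a = b" for a b using injP by (simp add: inj_eq)
  from this[of x y] have 3: "of_bool (Q y = y) + of_bool (del y Q x = x) = closings x y P"
    using xy by (auto simp: Q_def del_def closings_def)
  have 4: "X \<union> Y - {y} - {x} = (X - {x}) \<union> (Y - {y})"
    using a by (auto simp: bicoloured_def)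
  show ?thesis
    unfolding eq glue_def Q_def[symmetric] 1 2 4 3[symmetric] by (simp only: ac_simps)
qed

text \<open>
  The fundamental recursion. The left-hand side does not mention \<open>x\<close>, so the point whose partner
  is revealed can be chosen freely in each state; with \<open>mean_cycles_commute\<close> it can also be taken
  from \<open>Y\<close>.
\<close>

lemma mean_cycles_step:
  assumes a: "bicoloured (Suc k) P X Y" and x: "x \<in> X"
  shows "mean_cycles P X Y =
    (\<Sum>y\<in>Y. real (closings x y P) + mean_cycles (glue x y P) (X - {x}) (Y - {y})) / real (Suc k)"
proof -
  have "(\<Sum>\<tau>\<in>matchings X Y. real (ncyc (P \<circ> \<tau>) (X \<union> Y))) =
    (\<Sum>y\<in>Y. \<Sum>\<tau>\<in>matchings (X - {x}) (Y - {y}). real (ncyc (P \<circ> (\<tau> \<circ> swap x y)) (X \<union> Y)))"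
    using a x by (intro sum_matchings) (auto simp: bicoloured_def)
  also have "\<dots> = (\<Sum>y\<in>Y. fact k *
      (real (closings x y P) + mean_cycles (glue x y P) (X - {x}) (Y - {y})))"
  proof (rule sum.cong[OF refl])
    fix y assume y: "y \<in> Y"
    have "(\<Sum>\<tau>\<in>matchings (X - {x}) (Y - {y}). real (ncyc (P \<circ> (\<tau> \<circ> swap x y)) (X \<union> Y))) =
      (\<Sum>\<tau>\<in>matchings (X - {x}) (Y - {y}). real (closings x y P) +
         real (ncyc (glue x y P \<circ> \<tau>) ((X - {x}) \<union> (Y - {y}))))"
      by (rule sum.cong[OF refl]) (simp add: ncyc_glue[OF a x y])
    moreover have "card (matchings (X - {x}) (Y - {y})) = fact k"
      using card_matchings[of "X - {x}" "Y - {y}"] bicoloured_glue[OF a x y] by (auto simp: bicoloured_def)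
    moreover have "card (X - {x}) = k"
      using bicoloured_glue[OF a x y] by (auto simp: bicoloured_def)
    ultimately show "(\<Sum>\<tau>\<in>matchings (X - {x}) (Y - {y}).
        real (ncyc (P \<circ> (\<tau> \<circ> swap x y)) (X \<union> Y))) =
      fact k * (real (closings x y P) + mean_cycles (glue x y P) (X - {x}) (Y - {y}))"
      by (simp add: sum.distrib mean_cycles_def distrib_left)
  qed
  also have "\<dots> = fact k *
      (\<Sum>y\<in>Y. real (closings x y P) + mean_cycles (glue x y P) (X - {x}) (Y - {y}))"
    by (simp only: sum_distrib_left)
  finally have eq: "(\<Sum>\<tau>\<in>matchings X Y. real (ncyc (P \<circ> \<tau>) (X \<union> Y))) = fact k *
      (\<Sum>y\<in>Y. real (closings x y P) + mean_cycles (glue x y P) (X - {x}) (Y - {y}))" .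
  have "card X = Suc k" using a by (simp add: bicoloured_def)
  then have "mean_cycles P X Y = (fact k * (\<Sum>y\<in>Y. real (closings x y P) +
      mean_cycles (glue x y P) (X - {x}) (Y - {y}))) / (real (Suc k) * fact k)"
    unfolding mean_cycles_def[of P X Y] eq by (simp only: fact_Suc of_nat_mult of_nat_fact)
  then show ?thesis by (simp only: mult_divide_mult_cancel_right fact_nonzero mult.commute[of "fact k"] not_False_eq_True)
qed

lemma mean_cycles_nonneg: "0 \<le> mean_cycles P X Y"
  by (simp add: mean_cycles_def sum_nonneg)

lemma mean_cycles_empty: "bicoloured 0 P X Y \<Longrightarrow> mean_cycles P X Y = 0"
  by (auto simp: mean_cycles_def bicoloured_def ncyc_def)

lemma sum_closings:
  assumes a: "bicoloured k P X Y" and x: "x \<in> X"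
  shows "(\<Sum>y\<in>Y. real (closings x y P)) = of_bool (P x \<in> Y) + of_bool (\<exists>y\<in>Y. P y = x)
    + (if P x = x then real (card {y \<in> Y. P y = y}) else 0)"
proof -
  have fin: "finite Y" and inj: "inj P" using a by (auto simp: bicoloured_def permutes_inj)
  have 1: "(\<Sum>y\<in>Y. of_bool (P x = y)) = (of_bool (P x \<in> Y) :: real)"
    using fin by (simp add: of_bool_def sum.delta)
  have 2: "(\<Sum>y\<in>Y. of_bool (P y = x)) = (of_bool (\<exists>y\<in>Y. P y = x) :: real)"
  proof (cases "\<exists>y\<in>Y. P y = x")
    case True
    then obtain y where y: "y \<in> Y" "P y = x" by blast
    have "P y' = x \<longleftrightarrow> y = y'" for y' using y inj by (metis injD)
    then show ?thesis using fin True y by (simp add: of_bool_def sum.delta)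
  qed auto
  have 3: "(\<Sum>y\<in>Y. of_bool (P x = x \<and> P y = y)) =
      (if P x = x then real (card {y \<in> Y. P y = y}) else 0)"
  proof (cases "P x = x")
    case True
    then have "(\<Sum>y\<in>Y. of_bool (P x = x \<and> P y = y)) = (\<Sum>y\<in>Y. if P y = y then 1 else (0::real))"
      by (intro sum.cong) auto
    also have "\<dots> = real (card {y \<in> Y. P y = y})"
      using fin by (simp flip: sum.inter_filter)
    finally show ?thesis using True by simp
  qed simp
  show ?thesis unfolding closings_def by (simp add: sum.distrib 1 2 3)
qed

section \<open>States with at most one mixed cycle\<close>

definition pure :: "('a \<Rightarrow> 'a) \<Rightarrow> 'a set \<Rightarrow> 'a set \<Rightarrow> bool" where
  "pure P X Y \<longleftrightarrow> (\<forall>x\<in>X. P x \<in> X) \<and> (\<forall>y\<in>Y. P y \<in> Y)"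

text \<open>
  Together with \<open>cross_once P Y X\<close> this says that there is at most one cycle which meets both sets,
  and that it consists of one run in \<open>X\<close> followed by one run in \<open>Y\<close>.
\<close>

definition cross_once :: "('a \<Rightarrow> 'a) \<Rightarrow> 'a set \<Rightarrow> 'a set \<Rightarrow> bool" where
  "cross_once P X Y \<longleftrightarrow> (\<forall>a\<in>X. \<forall>b\<in>X. P a \<in> Y \<longrightarrow> P b \<in> Y \<longrightarrow> a = b)"

text \<open>
  There is exactly one mixed cycle; \<open>x0\<close> is the last point of its run in \<open>X\<close> and \<open>y0\<close> the last point of
  its run in \<open>Y\<close>. Hence \<open>P y0\<close> is the first point of the run in \<open>X\<close>, and \<open>P y0 = x0\<close> means that this
  run has length one.
\<close>

definition mixed_at :: "('a \<Rightarrow> 'a) \<Rightarrow> 'a set \<Rightarrow> 'a set \<Rightarrow> 'a \<Rightarrow> 'a \<Rightarrow> bool" where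
  "mixed_at P X Y x0 y0 \<longleftrightarrow> x0 \<in> X \<and> P x0 \<in> Y \<and> y0 \<in> Y \<and> P y0 \<in> X
     \<and> (\<forall>u\<in>X - {x0}. P u \<in> X) \<and> (\<forall>u\<in>Y - {y0}. P u \<in> Y)"

definition fixpts :: "('a \<Rightarrow> 'a) \<Rightarrow> 'a set \<Rightarrow> 'a set" where
  "fixpts P Z = {z \<in> Z. P z = z}"

lemma fixpts_Un: "fixpts P (A \<union> B) = fixpts P A \<union> fixpts P B"
  by (auto simp: fixpts_def)

lemma bicoloured_eq: "bicoloured k P X Y \<Longrightarrow> P a = P b \<longleftrightarrow> a = b"
  unfolding bicoloured_def using permutes_inj by (metis injD)

lemma bicoloured_in: "bicoloured k P X Y \<Longrightarrow> P z \<in> X \<or> P z \<in> Y \<longleftrightarrow> z \<in> X \<or> z \<in> Y"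
  unfolding bicoloured_def using permutes_in_image[of P "X \<union> Y" z] by auto

lemma bicoloured_disj: "bicoloured k P X Y \<Longrightarrow> z \<in> X \<Longrightarrow> z \<in> Y \<Longrightarrow> False"
  by (auto simp: bicoloured_def)

lemma pure_cross_once:
  "bicoloured k P X Y \<Longrightarrow> pure P X Y \<Longrightarrow> cross_once P X Y \<and> cross_once P Y X"
  by (auto simp: pure_def cross_once_def dest: bicoloured_disj)

lemma pure_commute: "pure P X Y \<longleftrightarrow> pure P Y X"
  by (auto simp: pure_def)

lemma mixed_at_commute: "mixed_at P Y X y0 x0 \<longleftrightarrow> mixed_at P X Y x0 y0"
  by (auto simp: mixed_at_def)

lemma mixed_at_cross_once:
  assumes "bicoloured k P X Y" "mixed_at P X Y x0 y0"
  shows "cross_once P X Y" "cross_once P Y X"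
  using assms(2) bicoloured_disj[OF assms(1)] unfolding mixed_at_def cross_once_def by blast+

lemma ex_crossing_back:
  assumes a: "bicoloured k P X Y" and x: "x \<in> X" "P x \<in> Y"
  shows "\<exists>y\<in>Y. P y \<in> X"
proof (rule ccontr)
  assume no: "\<not> ?thesis"
  then have "P ` Y \<subseteq> Y" using bicoloured_in[OF a] by blast
  moreover have "finite Y" "inj_on P Y" using a bicoloured_eq[OF a] by (auto simp: bicoloured_def inj_on_def)
  ultimately have "P ` Y = Y" by (intro endo_inj_surj)
  then obtain y where "y \<in> Y" "P y = P x" using x(2) by (metis imageE)
  then show False using bicoloured_eq[OF a] bicoloured_disj[OF a] x(1) by metis
qed

lemma cross_once_mixed_at:
  assumes a: "bicoloured k P X Y" and c: "cross_once P X Y" "cross_once P Y X" and "\<not> pure P X Y"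
  shows "\<exists>x0 y0. mixed_at P X Y x0 y0"
proof -
  have "(\<exists>x\<in>X. P x \<in> Y) \<or> (\<exists>y\<in>Y. P y \<in> X)"
    using assms(4) bicoloured_in[OF a] unfolding pure_def by blast
  then obtain x0 y0 where "x0 \<in> X" "P x0 \<in> Y" "y0 \<in> Y" "P y0 \<in> X"
    using ex_crossing_back[OF a] ex_crossing_back[OF bicoloured_commute[OF a]] by blast
  then have "mixed_at P X Y x0 y0"
    using c bicoloured_in[OF a] unfolding mixed_at_def cross_once_def by blast
  then show ?thesis by blast
qed

lemma mixed_at_inner:
  assumes "bicoloured k P X Y" "mixed_at P X Y x0 y0" "P y0 \<noteq> x0" "y \<in> Y"
  shows "P y \<noteq> x0"
  using assms bicoloured_disj[OF assms(1), of x0] by (cases "y = y0") (auto simp: mixed_at_def)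

text \<open>
  The four situations that occur: a point in the middle of a pure cycle, a fixed point, the last
  point of a run of length at least two, and a run of length one.
\<close>

lemma sum_closings_cases:
  assumes a: "bicoloured k P X Y" and x: "x \<in> X"
  shows "P x \<noteq> x \<Longrightarrow> P x \<notin> Y \<Longrightarrow> (\<And>y. y \<in> Y \<Longrightarrow> P y \<noteq> x) \<Longrightarrow> (\<Sum>y\<in>Y. real (closings x y P)) = 0"
    and "P x = x \<Longrightarrow> (\<Sum>y\<in>Y. real (closings x y P)) = real (card (fixpts P Y))"
    and "P x \<in> Y \<Longrightarrow> (\<And>y. y \<in> Y \<Longrightarrow> P y \<noteq> x) \<Longrightarrow> (\<Sum>y\<in>Y. real (closings x y P)) = 1"
    and "P x \<in> Y \<Longrightarrow> y \<in> Y \<Longrightarrow> P y = x \<Longrightarrow> (\<Sum>y\<in>Y. real (closings x y P)) = 2"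
  unfolding sum_closings[OF a x]
  using bicoloured_disj[OF a x] bicoloured_eq[OF a] x by (auto simp: fixpts_def)

lemma glue_fixed:
  assumes a: "bicoloured k P X Y" and z: "z \<in> X" "P z = z" and y: "y \<in> Y"
    and u: "u \<in> X \<and> u \<noteq> z \<or> u \<in> Y \<and> u \<noteq> y"
  shows "glue z y P u = (if P u = y then P y else P u)"
proof -
  have "inj P" "z \<noteq> y" using a z y by (auto simp: bicoloured_def permutes_inj)
  moreover have u: "u \<noteq> z" "u \<noteq> y" using bicoloured_disj[OF a] u z y by auto
  ultimately have "glue z y P u = (if P u = y then if P z = z then P y else P z
    else if P u = z then if P y = y then P z else P y else P u)"
    by (rule glue_apply)
  then show ?thesis using z u bicoloured_eq[OF a, of u z] by auto
qed

lemma glue_moved: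
  assumes a: "bicoloured k P X Y" and x: "x \<in> X" "P x \<noteq> x" and y: "y \<in> Y"
    and u: "u \<in> X \<and> u \<noteq> x \<or> u \<in> Y \<and> u \<noteq> y"
  shows "glue x y P u = (if P u = y then P x
    else if P u = x then if P y = y then P x else P y else P u)"
proof -
  have "inj P" "x \<noteq> y" using a x y by (auto simp: bicoloured_def permutes_inj)
  moreover have "u \<noteq> x" "u \<noteq> y" using bicoloured_disj[OF a] u x y by auto
  ultimately have "glue x y P u = (if P u = y then if P x = x then P y else P x
    else if P u = x then if P y = y then P x else P y else P u)"
    by (rule glue_apply)
  then show ?thesis using x by auto
qed

lemma glue_fixed_preserves:
  assumes a: "bicoloured k P X Y" and z: "z \<in> X" "P z = z" and y: "y \<in> Y"
  shows "cross_once P X Y \<Longrightarrow> cross_once (glue z y P) (X - {z}) (Y - {y})"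
    and "cross_once P Y X \<Longrightarrow> cross_once (glue z y P) (Y - {y}) (X - {z})"
    and "pure P X Y \<Longrightarrow> pure (glue z y P) (X - {z}) (Y - {y})"
    and "fixpts (glue z y P) ((X - {z}) \<union> (Y - {y})) \<subseteq> fixpts P (X \<union> Y) - {z} \<union> {P y}"
proof -
  note g = glue_fixed[OF a z y]
  note d = bicoloured_disj[OF a] and e = bicoloured_eq[OF a]
  show "cross_once (glue z y P) (X - {z}) (Y - {y})" if "cross_once P X Y"
    unfolding cross_once_def
  proof (intro ballI impI)
    fix u v assume uv: "u \<in> X - {z}" "v \<in> X - {z}"
      "glue z y P u \<in> Y - {y}" "glue z y P v \<in> Y - {y}"
    then have "P u \<in> Y" "P v \<in> Y" using g[of u] g[of v] y by (auto split: if_splits)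
    then show "u = v" using that uv by (auto simp: cross_once_def)
  qed
  show "cross_once (glue z y P) (Y - {y}) (X - {z})" if "cross_once P Y X"
    unfolding cross_once_def
  proof (intro ballI impI)
    fix u v assume uv: "u \<in> Y - {y}" "v \<in> Y - {y}"
      "glue z y P u \<in> X - {z}" "glue z y P v \<in> X - {z}"
    then have "P u \<in> X \<or> P u = y \<and> P y \<in> X" "P v \<in> X \<or> P v = y \<and> P y \<in> X"
      using g[of u] g[of v] by (auto split: if_splits)
    moreover have "u \<in> Y" "v \<in> Y" "u \<noteq> y" "v \<noteq> y" using uv by auto
    ultimately show "u = v" using that y e[of u v] unfolding cross_once_def by metis
  qed
  show "pure (glue z y P) (X - {z}) (Y - {y})" if p: "pure P X Y"
    unfolding pure_def
  proof (intro conjI ballI)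
    fix u assume u: "u \<in> X - {z}"
    then have "P u \<in> X" "P u \<noteq> z" using p e[of u z] z by (auto simp: pure_def)
    then show "glue z y P u \<in> X - {z}" using g[of u] u y d[of y] by (auto split: if_splits)
  next
    fix u assume u: "u \<in> Y - {y}"
    then have "P u \<in> Y" "P y \<in> Y" "P u \<noteq> P y" using p e[of u y] y by (auto simp: pure_def)
    then show "glue z y P u \<in> Y - {y}" using g[of u] u by (auto split: if_splits)
  qed
  show "fixpts (glue z y P) ((X - {z}) \<union> (Y - {y})) \<subseteq> fixpts P (X \<union> Y) - {z} \<union> {P y}"
  proof
    fix u assume "u \<in> fixpts (glue z y P) ((X - {z}) \<union> (Y - {y}))"
    then show "u \<in> fixpts P (X \<union> Y) - {z} \<union> {P y}"
      using g[of u] d[of z] z by (auto simp: fixpts_def split: if_splits)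
  qed
qed

text \<open>
  In a pure state the cycle of \<open>x\<close> and the cycle of \<open>y\<close> are joined to a mixed cycle; its run in \<open>X\<close> goes
  from \<open>P x\<close> to the predecessor \<open>x'\<close> of \<open>x\<close>. Nothing remains of the cycle of \<open>y\<close>, and the state stays
  pure, if \<open>y\<close> was a fixed point.
\<close>

lemma glue_pure:
  assumes a: "bicoloured k P X Y" and p: "pure P X Y" and x: "x \<in> X" "P x \<noteq> x" and y: "y \<in> Y"
  obtains x' y' where "x' \<in> X - {x}" "P x' = x"
    and "\<And>u. u \<in> X - {x} - {x'} \<Longrightarrow> glue x y P u = P u"
    and "P y \<noteq> y \<Longrightarrow> mixed_at (glue x y P) (X - {x}) (Y - {y}) x' y' \<and> glue x y P y' = P x"
    and "P y = y \<Longrightarrow> pure (glue x y P) (X - {x}) (Y - {y}) \<and> glue x y P x' = P x"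
    and "fixpts (glue x y P) (Y - {y}) = fixpts P Y - {y}"
proof -
  note d = bicoloured_disj[OF a] and e = bicoloured_eq[OF a]
  have PX: "u \<in> X \<Longrightarrow> P u \<in> X" and PY: "u \<in> Y \<Longrightarrow> P u \<in> Y" for u
    using p by (auto simp: pure_def)
  define x' y' where "x' = inv P x" and "y' = inv P y"
  have Px': "P x' = x" and Py': "P y' = y"
    unfolding x'_def y'_def using a by (metis bicoloured_def permutes_inverses(1))+
  have "x' \<in> X \<union> Y" "y' \<in> X \<union> Y" using bicoloured_in[OF a, of x'] bicoloured_in[OF a, of y'] x y Px' Py' by auto
  then have x': "x' \<in> X - {x}" and y': "y' \<in> Y"
    using PY[of x'] PX[of y'] Px' Py' d[of x] d[of y] x y by auto
  note g = glue_moved[OF a x y]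
  have QX: "glue x y P u = (if u = x' then if P y = y then P x else P y else P u)"
    if "u \<in> X - {x}" for u
    using that g[of u] PX[of u] d[of y] y e[of u x'] Px' by auto
  have QY: "glue x y P u = (if u = y' then P x else P u)" if "u \<in> Y - {y}" for u
    using that g[of u] PY[of u] d[of x] x e[of u y'] Py' by auto
  have PXx: "u \<in> X - {x} - {x'} \<Longrightarrow> P u \<in> X - {x}" for u
    using PX[of u] e[of u x'] Px' by auto
  have PYy: "u \<in> Y - {y} - {y'} \<Longrightarrow> P u \<in> Y - {y}" for u
    using PY[of u] e[of u y'] Py' by auto
  have ye: "y' = y \<longleftrightarrow> P y = y" using e[of y' y] Py' by auto
  show thesis
  proof (rule that[OF x' Px'])
    show "glue x y P u = P u" if "u \<in> X - {x} - {x'}" for u using QX that by auto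
    show "mixed_at (glue x y P) (X - {x}) (Y - {y}) x' y' \<and> glue x y P y' = P x" if ne: "P y \<noteq> y"
    proof
      have y'2: "y' \<in> Y - {y}" using y' ye ne by auto
      then show Qy': "glue x y P y' = P x" using QY by simp
      show "mixed_at (glue x y P) (X - {x}) (Y - {y}) x' y'"
        unfolding mixed_at_def
        using x' y'2 QX PXx QY PYy Qy' PX[OF x(1)] x PY[OF y] ne by auto
    qed
    show "pure (glue x y P) (X - {x}) (Y - {y}) \<and> glue x y P x' = P x" if eq: "P y = y"
    proof
      show Qx': "glue x y P x' = P x" using QX[OF x'] eq by simp
      show "pure (glue x y P) (X - {x}) (Y - {y})"
        unfolding pure_def
      proof (intro conjI ballI)
        show "glue x y P u \<in> X - {x}" if "u \<in> X - {x}" for u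
          using that QX[of u] PXx[of u] Qx' PX[of x] x by (cases "u = x'") auto
        show "glue x y P u \<in> Y - {y}" if "u \<in> Y - {y}" for u
          using that QY[of u] PYy[of u] eq ye by auto
      qed
    qed
    show "fixpts (glue x y P) (Y - {y}) = fixpts P Y - {y}"
    proof -
      have "glue x y P u = u \<longleftrightarrow> P u = u" if "u \<in> Y - {y}" for u
        using QY[OF that] that Py' PX[of x] x d[of "P x"] y' by auto
      then show ?thesis by (auto simp: fixpts_def)
    qed
  qed
qed

text \<open>
  If \<open>y\<close> lies in the mixed cycle, the part of the run in \<open>Y\<close> before \<open>y\<close> is split off as a cycle of its
  own, which is a fixed point if \<open>y\<close> is the second point of the run. The mixed cycle disappears
  exactly if \<open>y = y0\<close>, when nothing of the run in \<open>Y\<close> remains. If \<open>y\<close> lies in another cycle, the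
  other points of that cycle are put in front of the run.
\<close>

lemma glue_mixed:
  assumes a: "bicoloured k P X Y" and r: "mixed_at P X Y x0 y0" and inner: "P y0 \<noteq> x0" and y: "y \<in> Y"
  obtains x' where "x' \<in> X - {x0}" "P x' = x0"
    and "\<And>u. u \<in> X - {x0} - {x'} \<Longrightarrow> glue x0 y P u = P u"
    and "y \<noteq> y0 \<Longrightarrow> mixed_at (glue x0 y P) (X - {x0}) (Y - {y}) x' y0 \<and> glue x0 y P y0 = P y0"
    and "y = y0 \<Longrightarrow> pure (glue x0 y P) (X - {x0}) (Y - {y}) \<and> glue x0 y P x' = P y0"
    and "fixpts (glue x0 y P) (Y - {y}) \<subseteq> (fixpts P Y - {y}) \<union> (if P (P x0) = y then {P x0} else {})"
proof -
  note d = bicoloured_disj[OF a] and e = bicoloured_eq[OF a]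
  have x0: "x0 \<in> X" "P x0 \<in> Y" and y0: "y0 \<in> Y" "P y0 \<in> X"
    and PX: "u \<in> X \<Longrightarrow> u \<noteq> x0 \<Longrightarrow> P u \<in> X" and PY: "u \<in> Y \<Longrightarrow> u \<noteq> y0 \<Longrightarrow> P u \<in> Y" for u
    using r by (auto simp: mixed_at_def)
  have nx: "P x0 \<noteq> x0" using d[of x0] x0 by auto
  define x' where "x' = inv P x0"
  have Px': "P x' = x0"
    unfolding x'_def using a by (metis bicoloured_def permutes_inverses(1))
  have Yx: "u \<in> Y \<Longrightarrow> P u \<noteq> x0" for u
    using PY[of u] inner d[of x0] x0 by (cases "u = y0") auto
  have "x' \<in> X \<union> Y" using bicoloured_in[OF a, of x'] x0 Px' by auto
  then have x': "x' \<in> X - {x0}" using Yx[of x'] Px' nx by auto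
  note g = glue_moved[OF a x0(1) nx y]
  have QX: "glue x0 y P u = (if u = x' then if P y = y then P x0 else P y else P u)"
    if "u \<in> X - {x0}" for u
    using that g[of u] PX[of u] d[of y] y e[of u x'] Px' by auto
  have QY: "glue x0 y P u = (if P u = y then P x0 else P u)" if "u \<in> Y - {y}" for u
    using that g[of u] Yx[of u] by auto
  have PXx: "u \<in> X - {x0} - {x'} \<Longrightarrow> P u \<in> X - {x0}" for u
    using PX[of u] e[of u x'] Px' by auto
  have PxY: "P x0 \<noteq> y" if "P u = y" "u \<in> Y" for u
    using that e[of u x0] d[of x0] x0 by auto
  show thesis
  proof (rule that[OF x' Px'])
    show "glue x0 y P u = P u" if "u \<in> X - {x0} - {x'}" for u using QX that by auto
    show "mixed_at (glue x0 y P) (X - {x0}) (Y - {y}) x' y0 \<and> glue x0 y P y0 = P y0" if ne: "y \<noteq> y0"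
    proof
      have Qy0: "glue x0 y P y0 = P y0" using QY[of y0] y0 ne d[of y] y by auto
      then show "glue x0 y P y0 = P y0" .
      have Py: "P y \<in> Y" using PY y ne by blast
      show "mixed_at (glue x0 y P) (X - {x0}) (Y - {y}) x' y0"
        unfolding mixed_at_def
      proof (intro conjI ballI)
        show "glue x0 y P x' \<in> Y - {y}" using QX[OF x'] Py x0 PxY[of y] y by auto
        show "glue x0 y P u \<in> X - {x0}" if "u \<in> X - {x0} - {x'}" for u
          using that QX[of u] PXx[of u] by auto
        show "glue x0 y P u \<in> Y - {y}" if "u \<in> Y - {y} - {y0}" for u
          using that QY[of u] PY[of u] PxY[of u] x0 by auto
      qed (use x' y0 ne inner Qy0 in auto)
    qed
    show "pure (glue x0 y P) (X - {x0}) (Y - {y}) \<and> glue x0 y P x' = P y0" if eq: "y = y0"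
    proof
      have "P y \<noteq> y" using eq y0 y d[of y] by auto
      then show Qx': "glue x0 y P x' = P y0" using QX[OF x'] eq by simp
      show "pure (glue x0 y P) (X - {x0}) (Y - {y})"
        unfolding pure_def
      proof (intro conjI ballI)
        show "glue x0 y P u \<in> X - {x0}" if "u \<in> X - {x0}" for u
          using that QX[of u] PXx[of u] Qx' y0 inner by (cases "u = x'") auto
        show "glue x0 y P u \<in> Y - {y}" if "u \<in> Y - {y}" for u
          using that QY[of u] PY[of u] PxY[of u] x0 eq by auto
      qed
    qed
    show "fixpts (glue x0 y P) (Y - {y}) \<subseteq> (fixpts P Y - {y}) \<union> (if P (P x0) = y then {P x0} else {})"
    proof
      fix u assume "u \<in> fixpts (glue x0 y P) (Y - {y})"
      then have u: "u \<in> Y - {y}" "glue x0 y P u = u" by (auto simp: fixpts_def)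
      show "u \<in> (fixpts P Y - {y}) \<union> (if P (P x0) = y then {P x0} else {})"
        using QY[OF u(1)] u by (auto simp: fixpts_def split: if_splits)
    qed
  qed
qed

text \<open>
  With a run of length one in \<open>X\<close>, the mixed cycle loses its only point in \<open>X\<close>. The run in \<open>Y\<close> is
  either merged with the cycle of \<open>y\<close> or split at \<open>y\<close> into two cycles. In the latter case its first
  point \<open>P x0\<close> becomes a fixed point if \<open>y\<close> was the second point, and its last point \<open>y0\<close> becomes one
  if \<open>y\<close> was the last point but one.
\<close>

lemma glue_mixed_last:
  assumes a: "bicoloured k P X Y" and r: "mixed_at P X Y x0 y0" and last: "P y0 = x0" and y: "y \<in> Y"
  shows "pure (glue x0 y P) (X - {x0}) (Y - {y})"
    and "u \<in> X - {x0} \<Longrightarrow> glue x0 y P u = P u"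
    and "fixpts (glue x0 y P) (Y - {y}) \<subseteq> (fixpts P Y - {y}) \<union> (if P (P x0) = y then {P x0} else {})
      \<union> (if P y = y0 \<or> P y = y \<and> P x0 = y0 then {y0} else {})"
proof -
  note d = bicoloured_disj[OF a] and e = bicoloured_eq[OF a]
  have x0: "x0 \<in> X" "P x0 \<in> Y" and y0: "y0 \<in> Y"
    and PX: "u \<in> X \<Longrightarrow> u \<noteq> x0 \<Longrightarrow> P u \<in> X" and PY: "u \<in> Y \<Longrightarrow> u \<noteq> y0 \<Longrightarrow> P u \<in> Y" for u
    using r by (auto simp: mixed_at_def)
  have nx: "P x0 \<noteq> x0" using d[of x0] x0 by auto
  note g = glue_moved[OF a x0(1) nx y]
  show agree: "glue x0 y P u = P u" if "u \<in> X - {x0}" for u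
    using that g[of u] PX[of u] d[of y] y e[of u y0] last d[of y0] y0 by auto
  have Q: "glue x0 y P u = (if P u = y then P x0 else if u = y0 then if P y = y then P x0 else P y else P u)"
    if "u \<in> Y - {y}" for u
    using that g[of u] e[of u y0] last by auto
  show "pure (glue x0 y P) (X - {x0}) (Y - {y})"
    unfolding pure_def
  proof (intro conjI ballI)
    fix u assume u: "u \<in> X - {x0}"
    then show "glue x0 y P u \<in> X - {x0}"
      using agree[of u] PX[of u] e[of u y0] last d[of y0] y0 by auto
  next
    fix u assume u: "u \<in> Y - {y}"
    have "P x0 \<noteq> y \<or> P u \<noteq> y" using e[of u x0] d[of x0] x0 u by auto
    moreover have "P y \<in> Y" if "y \<noteq> y0" using PY y that by blast
    moreover have "P x0 \<noteq> y" if "P y = y" using that e[of y x0] d[of x0] x0 y by auto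
    moreover have "x0 \<notin> Y" using d x0 by auto
    ultimately show "glue x0 y P u \<in> Y - {y}"
      using u Q[of u] PY[of u] x0 last by (auto split: if_splits)
  qed
  show "fixpts (glue x0 y P) (Y - {y}) \<subseteq> (fixpts P Y - {y}) \<union> (if P (P x0) = y then {P x0} else {})
      \<union> (if P y = y0 \<or> P y = y \<and> P x0 = y0 then {y0} else {})"
  proof
    fix u assume "u \<in> fixpts (glue x0 y P) (Y - {y})"
    then have u: "u \<in> Y - {y}" "glue x0 y P u = u" by (auto simp: fixpts_def)
    show "u \<in> (fixpts P Y - {y}) \<union> (if P (P x0) = y then {P x0} else {})
      \<union> (if P y = y0 \<or> P y = y \<and> P x0 = y0 then {y0} else {})"
      using Q[OF u(1)] u by (auto simp: fixpts_def split: if_splits)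
  qed
qed

section \<open>The upper bound\<close>

text \<open>
  The states that the strategy for the upper bound can meet. Two fixed points at once arise only
  when the mixed cycle has just disappeared, and both are revealed before a new mixed cycle is
  started.
\<close>

definition tame :: "('a \<Rightarrow> 'a) \<Rightarrow> 'a set \<Rightarrow> 'a set \<Rightarrow> bool" where
  "tame P X Y \<longleftrightarrow> cross_once P X Y \<and> cross_once P Y X \<and> card (fixpts P (X \<union> Y)) \<le> 1
     \<or> pure P X Y \<and> card (fixpts P (X \<union> Y)) \<le> 2"

lemma tame_commute: "tame P X Y \<longleftrightarrow> tame P Y X"
  by (auto simp: tame_def pure_commute[of P X] Un_commute)

lemma tame_cross_once:
  "bicoloured k P X Y \<Longrightarrow> tame P X Y \<Longrightarrow> cross_once P X Y \<and> cross_once P Y X"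
  unfolding tame_def using pure_cross_once by blast

lemma mean_cycles_le:
  assumes a: "bicoloured (Suc k) P X Y" and x: "x \<in> X"
    and c: "(\<Sum>y\<in>Y. real (closings x y P)) \<le> c"
    and B: "\<And>y. y \<in> Y \<Longrightarrow> mean_cycles (glue x y P) (X - {x}) (Y - {y}) \<le> B"
  shows "mean_cycles P X Y \<le> B + c / real (Suc k)"
proof -
  have "(\<Sum>y\<in>Y. mean_cycles (glue x y P) (X - {x}) (Y - {y})) \<le> real (Suc k) * B"
    using sum_bounded_above[of Y "\<lambda>y. mean_cycles (glue x y P) (X - {x}) (Y - {y})" B] B a
    by (auto simp: bicoloured_def)
  then have "mean_cycles P X Y \<le> (c + real (Suc k) * B) / real (Suc k)"
    unfolding mean_cycles_step[OF a x] sum.distrib using c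
    by (intro divide_right_mono) auto
  then show ?thesis by (simp add: add_divide_distrib)
qed

text \<open>
  When a fixed point \<open>z\<close> is revealed, its partner is simply cut out of its cycle. This creates a
  fixed point only if that cycle had length two, so the number of fixed points does not grow, as \<open>z\<close>
  itself disappears. The only partner that closes a cycle is another fixed point, and there is at
  most one.
\<close>

lemma mean_cycles_upper_fixed:
  fixes P :: "'a \<Rightarrow> 'a"
  assumes a: "bicoloured (Suc k) P X Y" and t: "tame P X Y" and z: "z \<in> X" "P z = z"
    and IH: "\<And>Q X' Y' :: 'a set. bicoloured k Q X' Y' \<Longrightarrow> tame Q X' Y' \<Longrightarrow>
      mean_cycles Q X' Y' \<le> harm k + 1"
  shows "mean_cycles P X Y \<le> harm (Suc k) + 1"
proof -
  have fin: "finite (fixpts P (X \<union> Y))" using a by (auto simp: bicoloured_def fixpts_def)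
  have zf: "z \<in> fixpts P (X \<union> Y)" using z by (auto simp: fixpts_def)
  have "card (fixpts P (X \<union> Y) - {z}) \<le> 1"
    using t zf fin by (auto simp: tame_def card_Diff_singleton)
  moreover have "fixpts P Y \<subseteq> fixpts P (X \<union> Y) - {z}"
    using z bicoloured_disj[OF a] by (auto simp: fixpts_def)
  ultimately have "card (fixpts P Y) \<le> 1"
    using card_mono[OF finite_Diff[OF fin]] by (meson le_trans)
  then have "(\<Sum>y\<in>Y. real (closings z y P)) \<le> 1" using sum_closings_cases(2)[OF a z] by simp
  moreover have "mean_cycles (glue z y P) (X - {z}) (Y - {y}) \<le> harm k + 1" if y: "y \<in> Y" for y
  proof (rule IH[OF bicoloured_glue[OF a z(1) y]])
    note p = glue_fixed_preserves[OF a z y]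
    have "card (fixpts (glue z y P) ((X - {z}) \<union> (Y - {y}))) \<le> card (fixpts P (X \<union> Y) - {z} \<union> {P y})"
      using p(4) fin by (intro card_mono) auto
    also have "\<dots> \<le> card (fixpts P (X \<union> Y) - {z}) + 1"
      by (metis card_Un_le is_singletonI is_singleton_altdef)
    also have "\<dots> = card (fixpts P (X \<union> Y))"
      using zf fin by (metis Suc_eq_plus1 card.remove)
    finally show "tame (glue z y P) (X - {z}) (Y - {y})"
      using t p unfolding tame_def by auto
  qed
  ultimately have "mean_cycles P X Y \<le> (harm k + 1) + 1 / real (Suc k)"
    by (intro mean_cycles_le[OF a z(1)])
  then show ?thesis by (simp add: harm_Suc field_simps)
qed

text \<open>
  Without fixed points and with an \<open>X\<close>-run of length at least two, the last point \<open>x\<close> of that run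
  has exactly one neighbour in \<open>Y\<close>, so the step closes one cycle for exactly one of its equally
  likely outcomes. At most two fixed points arise: the first point of the \<open>Y\<close>-run when it is cut
  off alone, and what is left of an \<open>X\<close>-run of length two when the whole \<open>Y\<close>-run is cut off; in
  the latter case no mixed cycle survives.
\<close>

lemma mean_cycles_upper_mixed:
  fixes P :: "'a \<Rightarrow> 'a"
  assumes a: "bicoloured (Suc k) P X Y" and f: "fixpts P (X \<union> Y) = {}"
    and r: "mixed_at P X Y x y0" and inner: "P y0 \<noteq> x"
    and IH: "\<And>Q X' Y' :: 'a set. bicoloured k Q X' Y' \<Longrightarrow> tame Q X' Y' \<Longrightarrow>
      mean_cycles Q X' Y' \<le> harm k + 1"
  shows "mean_cycles P X Y \<le> harm (Suc k) + 1"
proof -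
  have x: "x \<in> X" "P x \<in> Y" using r by (auto simp: mixed_at_def)
  have "(\<Sum>y\<in>Y. real (closings x y P)) = 1"
    using sum_closings_cases(3)[OF a x] mixed_at_inner[OF a r inner] by blast
  moreover have "mean_cycles (glue x y P) (X - {x}) (Y - {y}) \<le> harm k + 1" if y: "y \<in> Y" for y
  proof (rule IH[OF bicoloured_glue[OF a x(1) y]])
    let ?Q = "glue x y P" and ?X = "X - {x}" and ?Y = "Y - {y}"
    obtain x' where x': "x' \<in> ?X"
      and agree: "\<And>u. u \<in> ?X - {x'} \<Longrightarrow> ?Q u = P u"
      and r': "y \<noteq> y0 \<Longrightarrow> mixed_at ?Q ?X ?Y x' y0"
      and p: "y = y0 \<Longrightarrow> pure ?Q ?X ?Y"
      and v: "fixpts ?Q ?Y \<subseteq> (fixpts P Y - {y}) \<union> (if P (P x) = y then {P x} else {})"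
      using glue_mixed[OF a r inner y] by metis
    have "?Q u \<noteq> u" if "u \<in> ?X - {x'}" for u
      using agree[OF that] that f by (auto simp: fixpts_def)
    then have fX: "fixpts ?Q ?X \<subseteq> {x'}" by (auto simp: fixpts_def)
    have fY: "fixpts ?Q ?Y \<subseteq> {P x}" using v f by (auto simp: fixpts_def split: if_splits)
    show "tame ?Q ?X ?Y"
    proof (cases "y = y0")
      case True
      have "card (fixpts ?Q (?X \<union> ?Y)) \<le> card {x', P x}"
        using fX fY unfolding fixpts_Un by (intro card_mono) auto
      then show ?thesis using p[OF True] by (auto simp: tame_def card_insert_if split: if_splits)
    next
      case False
      note a' = bicoloured_glue[OF a x(1) y]
      have "?Q x' \<noteq> x'" using r'[OF False] bicoloured_disj[OF a', of x']
        by (auto simp: mixed_at_def)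
      then have "fixpts ?Q (?X \<union> ?Y) \<subseteq> {P x}" using fX fY unfolding fixpts_Un by (auto simp: fixpts_def)
      then have "card (fixpts ?Q (?X \<union> ?Y)) \<le> card {P x}" by (intro card_mono) auto
      then show ?thesis using mixed_at_cross_once[OF a' r'[OF False]] by (simp add: tame_def)
    qed
  qed
  ultimately have "mean_cycles P X Y \<le> (harm k + 1) + 1 / real (Suc k)"
    by (intro mean_cycles_le[OF a x(1)]) auto
  then show ?thesis by (simp add: harm_Suc field_simps)
qed

text \<open>
  The two claims feed each other. A pure state without fixed points closes nothing in the next
  step and thus has \<open>1 / k\<close> to spare. The only state with more than the regular closing rate is a
  mixed cycle \<open>x \<mapsto> y \<mapsto> x\<close> of length two, where revealing \<open>x\<close> closes two cycles with probability
  \<open>1 / k\<close>; but it always leads to a pure state without fixed points, whose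
  reserve \<open>1 / (k - 1)\<close> pays for the surplus \<open>1 / k\<close>. The surplus remains unpaid only when \<open>k = 1\<close>,
  which is the reason for the summand one.
\<close>

lemma mean_cycles_upper:
  assumes "bicoloured k P X Y"
  shows "(tame P X Y \<longrightarrow> mean_cycles P X Y \<le> harm k + 1) \<and>
    (pure P X Y \<and> fixpts P (X \<union> Y) = {} \<and> 0 < k \<longrightarrow> mean_cycles P X Y \<le> harm k + 1 - 1 / real k)"
  using assms
proof (induction k arbitrary: P X Y)
  case 0
  then show ?case by (simp add: mean_cycles_empty harm_def)
next
  case (Suc k)
  note a = \<open>bicoloured (Suc k) P X Y\<close>
  note d = bicoloured_disj[OF a] and e = bicoloured_eq[OF a]
  have IH: "mean_cycles Q X' Y' \<le> harm k + 1" if "bicoloured k Q X' Y'" "tame Q X' Y'"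
    for Q and X' Y' :: "'a set"
    using Suc.IH that by blast
  have pure: "mean_cycles P X Y \<le> harm (Suc k) + 1 - 1 / real (Suc k)"
    if p: "pure P X Y" and f: "fixpts P (X \<union> Y) = {}"
  proof -
    obtain x where x: "x \<in> X" using a by (metis bicoloured_def card.empty equals0I nat.distinct(1))
    have nf: "u \<in> X \<union> Y \<Longrightarrow> P u \<noteq> u" for u using f by (auto simp: fixpts_def)
    have Px: "P x \<noteq> x" using nf x by blast
    have "(\<Sum>y\<in>Y. real (closings x y P)) = 0"
      using p x d Px by (intro sum_closings_cases(1)[OF a x]) (auto simp: pure_def)
    moreover have "mean_cycles (glue x y P) (X - {x}) (Y - {y}) \<le> harm k + 1" if y: "y \<in> Y" for y
    proof (rule IH[OF bicoloured_glue[OF a x y]])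
      let ?Q = "glue x y P" and ?X = "X - {x}" and ?Y = "Y - {y}"
      note a' = bicoloured_glue[OF a x y]
      have Py: "P y \<noteq> y" using nf y by blast
      obtain x' y' where agree: "\<And>u. u \<in> ?X - {x'} \<Longrightarrow> ?Q u = P u"
        and r: "mixed_at ?Q ?X ?Y x' y'" and v: "fixpts ?Q ?Y = fixpts P Y - {y}"
        by (rule glue_pure[OF a p x Px y]) (use Py in blast)
      have "?Q u \<noteq> u" if "u \<in> ?X" for u
        using agree[of u] nf[of u] that r bicoloured_disj[OF a', of x']
        by (cases "u = x'") (auto simp: mixed_at_def)
      then have "fixpts ?Q (?X \<union> ?Y) = {}"
        using v f unfolding fixpts_Un by (auto simp: fixpts_def)
      then show "tame ?Q ?X ?Y" using mixed_at_cross_once[OF a' r] by (simp add: tame_def)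
    qed
    ultimately have "mean_cycles P X Y \<le> (harm k + 1) + 0 / real (Suc k)"
      by (intro mean_cycles_le[OF a x]) auto
    then show ?thesis by (simp add: harm_Suc inverse_eq_divide)
  qed
  have "mean_cycles P X Y \<le> harm (Suc k) + 1" if t: "tame P X Y"
  proof (cases "fixpts P (X \<union> Y) = {}")
    case False
    then obtain z where z: "P z = z" "z \<in> X \<or> z \<in> Y" by (auto simp: fixpts_def)
    show ?thesis
    proof (cases "z \<in> X")
      case True
      from mean_cycles_upper_fixed[OF a t this z(1) IH] show ?thesis .
    next
      case False
      with z have "z \<in> Y" by simp
      from mean_cycles_upper_fixed[OF bicoloured_commute[OF a] _ this z(1) IH] t
      show ?thesis by (simp add: tame_commute mean_cycles_commute[OF a])
    qed
  next
    case f: True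
    show ?thesis
    proof (cases "pure P X Y")
      case True
      from pure[OF this f] show ?thesis by (smt (verit) divide_nonneg_nonneg of_nat_0_le_iff)
    next
      case False
      then obtain x0 y0 where r: "mixed_at P X Y x0 y0"
        using cross_once_mixed_at[OF a] tame_cross_once[OF a t] by blast
      have x0: "x0 \<in> X" "P x0 \<in> Y" and y0: "y0 \<in> Y" using r by (auto simp: mixed_at_def)
      consider "P y0 \<noteq> x0" | "P x0 \<noteq> y0" | "P y0 = x0" "P x0 = y0" by blast
      then show ?thesis
      proof cases
        case 1
        from mean_cycles_upper_mixed[OF a f r this IH] show ?thesis .
      next
        case 2
        from mean_cycles_upper_mixed[OF bicoloured_commute[OF a] _ mixed_at_commute[THEN iffD2, OF r] this IH] f
        show ?thesis by (simp add: mean_cycles_commute[OF a] Un_commute)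
      next
        case 3
        \<comment> \<open>The mixed cycle is \<open>x0 \<mapsto> y0 \<mapsto> x0\<close>.\<close>
        have s: "(\<Sum>y\<in>Y. real (closings x0 y P)) = 2"
          by (rule sum_closings_cases(4)[OF a x0 y0 3(1)])
        have nx: "pure (glue x0 y P) (X - {x0}) (Y - {y})"
          "fixpts (glue x0 y P) ((X - {x0}) \<union> (Y - {y})) = {}" if y: "y \<in> Y" for y
        proof -
          note g = glue_mixed_last[OF a r 3(1) y]
          show "pure (glue x0 y P) (X - {x0}) (Y - {y})" by (rule g(1))
          have "P (P x0) \<noteq> y" "P y \<noteq> y0" "P y \<noteq> y"
            using 3 y d[of x0] x0 e[of y x0] f by (auto simp: fixpts_def)
          then have "fixpts (glue x0 y P) (Y - {y}) = {}"
            using g(3) f by (auto simp: fixpts_def)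
          moreover have "fixpts (glue x0 y P) (X - {x0}) = {}"
            unfolding fixpts_def using f by (auto simp: fixpts_def g(2))
          ultimately show "fixpts (glue x0 y P) ((X - {x0}) \<union> (Y - {y})) = {}"
            by (simp add: fixpts_Un)
        qed
        show ?thesis
        proof (cases "k = 0")
          case True
          have "mean_cycles (glue x0 y P) (X - {x0}) (Y - {y}) = 0" if "y \<in> Y" for y
            using mean_cycles_empty bicoloured_glue[OF a x0(1) that] unfolding True by blast
          then have "mean_cycles P X Y \<le> 0 + 2 / real (Suc k)"
            using s by (intro mean_cycles_le[OF a x0(1)]) auto
          then show ?thesis using True by (simp add: harm_def)
        next
          case False
          have "mean_cycles P X Y \<le> (harm k + 1 - 1 / real k) + 2 / real (Suc k)"
            using s Suc.IH[OF bicoloured_glue[OF a x0(1)]] nx False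
            by (intro mean_cycles_le[OF a x0(1)]) auto
          also have "\<dots> = harm (Suc k) + 1 - (1 / real k - 1 / real (Suc k))"
            by (simp add: harm_Suc inverse_eq_divide)
          also have "\<dots> \<le> harm (Suc k) + 1"
            using False by (simp add: frac_le)
          finally show ?thesis .
        qed
      qed
    qed
  qed
  with pure show ?case by blast
qed

section \<open>The lower bound: the potential\<close>

text \<open>
  This is \<open>(2k choose k) / 4 ^ k\<close>, of order \<open>1 / sqrt k\<close>. It measures the damage that one fixed point in
  \<open>Y\<close> can still do when \<open>k\<close> pairs are left. The order is dictated by two requirements. When an
  \<open>X\<close>-cycle of length at least three is revealed, all steps except the last one remove each fixed
  point with probability \<open>1 / k\<close>, so that per step the mean number of fixed points falls by a
  factor of at most about \<open>1 - 2 / (3k)\<close>, while the weight rises only by a factor of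
  \<open>1 + 1 / (2k)\<close>. And the new fixed points, which appear with probability of order \<open>1 / k\<close> per step,
  have a total weight of order \<open>\<Sum>k. weight k / k\<close>, which converges.
\<close>

primrec weight :: "nat \<Rightarrow> real" where
  "weight 0 = 1"
| "weight (Suc k) = weight k * ((2 * real k + 1) / (2 * real k + 2))"

lemma weight_pos: "0 < weight k"
  by (induction k) auto

text \<open>
  The comparison function decreases faster than the weight only from \<open>k = 6\<close> on; the values before
  are checked one by one.
\<close>

lemma weight_ge: "1 \<le> k \<Longrightarrow> 2 / (real k + 7) \<le> weight k"
proof (induction k rule: dec_induct)
  case base
  show ?case by simp
next
  case (step k)
  consider "k = 1" | "k = 2" | "k = 3" | "k = 4" | "k = 5" | "6 \<le> k" using step by linarith
  then show ?case
  proof cases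
    case 6
    have "2 / (real (Suc k) + 7) \<le> 2 / (real k + 7) * ((2 * real k + 1) / (2 * real k + 2))"
      using 6 by (simp add: divide_simps) (simp add: algebra_simps)
    also have "\<dots> \<le> weight k * ((2 * real k + 1) / (2 * real k + 2))"
      using step by (intro mult_right_mono) auto
    finally show ?thesis by simp
  qed (simp_all add: numeral_eq_Suc)
qed

lemma weight_le: "2 \<le> k \<Longrightarrow> weight k \<le> 3 / 8"
proof (induction k rule: dec_induct)
  case base
  show ?case by (simp add: numeral_eq_Suc)
next
  case (step k)
  have "weight (Suc k) \<le> weight k * 1"
    unfolding weight.simps using weight_pos[of k] by (intro mult_left_mono) (auto simp: divide_simps)
  then show ?case using step.IH by linarith
qed

definition loss_const :: "nat \<Rightarrow> real" where
  "loss_const k = (if k = 0 then 0 else 3 - 6 * weight k)"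

definition loss_slope :: "nat \<Rightarrow> real" where
  "loss_slope k = (if k = 0 then 0 else weight k)"

text \<open>
  An upper bound for the amount by which the mean number of cycles can fall short of \<open>harm k\<close> in a
  pure state with \<open>v\<close> fixed points, all of them in \<open>Y\<close>. The potential \<open>v - 6\<close> instead of \<open>v\<close> makes the
  growth of the weight pay for the creation of new fixed points: as long as \<open>v\<close> is small, each step
  gains about \<open>(6 - v) * weight k / (2 * k)\<close>. For \<open>k = 0\<close> nothing can be lost.
\<close>

definition loss :: "nat \<Rightarrow> real \<Rightarrow> real" where
  "loss k v = loss_const k + loss_slope k * v"

lemma loss_slope_nonneg: "0 \<le> loss_slope k"
  using weight_pos[of k] by (simp add: loss_slope_def)

text \<open>
  The next three lemmas balance the account of a step, summed over its equally likely outcomes. The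
  factor of \<open>loss_slope\<close> bounds the sum of the new numbers of fixed points. The last of them covers
  the step in which the run in \<open>X\<close> shrinks from two points to one, together with the step after it.
\<close>

lemma loss_mixed_step:
  assumes "1 \<le> k" "0 \<le> v"
  shows "real (Suc k) * loss_const k + loss_slope k * (real (Suc k) * v + 1 - v) \<le> real (Suc k) * loss (Suc k) v"
proof -
  have "real (Suc k) * loss (Suc k) v -
      (real (Suc k) * loss_const k + loss_slope k * (real (Suc k) * v + 1 - v)) = weight k * (2 + v / 2)"
    using assms by (simp add: loss_def loss_const_def loss_slope_def divide_simps) (simp add: algebra_simps)
  also have "\<dots> \<ge> 0" using assms weight_pos[of k] by (intro mult_nonneg_nonneg) auto
  finally show ?thesis by simp
qed

lemma loss_pure_step:
  assumes "1 \<le> k" "0 \<le> v" "v \<le> real (Suc k)"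
  shows "real (Suc k) * loss_const k + loss_slope k * (real (Suc k) * v - v) + (v - 1) / real k
    \<le> real (Suc k) * loss (Suc k) v"
proof -
  have "real (Suc k) * loss (Suc k) v -
      (real (Suc k) * loss_const k + loss_slope k * (real (Suc k) * v - v)) = weight k * (6 + v) / 2"
    using assms by (simp add: loss_def loss_const_def loss_slope_def divide_simps) (simp add: algebra_simps)
  moreover have "(v - 1) / real k \<le> weight k * (6 + v) / 2"
  proof -
    have "(v - 1) * (real k + 7) \<le> real k * (6 + v)"
      using assms by (simp add: algebra_simps)
    then have "(v - 1) / real k \<le> 2 / (real k + 7) * (6 + v) / 2"
      using assms by (simp add: field_simps)
    also have "\<dots> \<le> weight k * (6 + v) / 2"
      using weight_ge[OF assms(1)] assms by (intro divide_right_mono mult_right_mono) auto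
    finally show ?thesis .
  qed
  ultimately show ?thesis by linarith
qed

lemma loss_double_step:
  assumes "0 \<le> v" "v \<le> real (Suc (Suc j))"
  shows "real (Suc (Suc j)) * loss_const j + loss_slope j * (real (Suc (Suc j)) * v + 4 - v) + 1 / real (Suc j)
    \<le> real (Suc (Suc j)) * loss (Suc (Suc j)) v"
proof (cases "j = 0")
  case True
  then show ?thesis using assms by (simp add: loss_def loss_const_def loss_slope_def)
next
  case False
  have "real (Suc (Suc j)) * loss (Suc (Suc j)) v -
      (real (Suc (Suc j)) * loss_const j + loss_slope j * (real (Suc (Suc j)) * v + 4 - v)) =
      weight j * (2 * real j + 7 / 2 - v / 4) / real (Suc j)"
    using False by (simp add: loss_def loss_const_def loss_slope_def divide_simps) (simp add: algebra_simps)
  moreover have "1 \<le> weight j * (2 * real j + 7 / 2 - v / 4)"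
  proof -
    have "1 \<le> 2 / (real j + 7) * (2 * real j + 7 / 2 - v / 4)"
      using False assms by (simp add: divide_simps)
    also have "\<dots> \<le> weight j * (2 * real j + 7 / 2 - v / 4)"
      using weight_ge[of j] False assms by (intro mult_right_mono) auto
    finally show ?thesis .
  qed
  then have "1 / real (Suc j) \<le> weight j * (2 * real j + 7 / 2 - v / 4) / real (Suc j)"
    by (intro divide_right_mono) auto
  ultimately show ?thesis by linarith
qed

section \<open>The lower bound: single steps\<close>

lemma mean_cycles_ge:
  assumes a: "bicoloured (Suc k) P X Y" and x: "x \<in> X"
    and c: "c \<le> (\<Sum>y\<in>Y. real (closings x y P))"
    and m: "\<And>y. y \<in> Y \<Longrightarrow> m y \<le> mean_cycles (glue x y P) (X - {x}) (Y - {y})"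
    and s: "real (Suc k) * B \<le> c + (\<Sum>y\<in>Y. m y)"
  shows "B \<le> mean_cycles P X Y"
proof -
  have "(\<Sum>y\<in>Y. m y) \<le> (\<Sum>y\<in>Y. mean_cycles (glue x y P) (X - {x}) (Y - {y}))"
    using m by (intro sum_mono)
  with c s show ?thesis
    unfolding mean_cycles_step[OF a x] sum.distrib by (simp add: le_divide_eq mult.commute)
qed

lemma sum_of_bool_le_1:
  assumes "finite Y" "\<And>y z. y \<in> Y \<Longrightarrow> z \<in> Y \<Longrightarrow> A y \<Longrightarrow> A z \<Longrightarrow> y = z"
  shows "(\<Sum>y\<in>Y. of_bool (A y)) \<le> (1 :: real)"
proof -
  have "card (Y \<inter> {y. A y}) \<le> 1"
    unfolding One_nat_def using assms by (subst card_le_Suc0_iff_eq) auto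
  then show ?thesis using assms(1) by (simp add: sum_of_bool_eq)
qed

lemma sum_fixpts: "finite Y \<Longrightarrow> (\<Sum>y\<in>Y. of_bool (P y = y)) = real (card (fixpts P Y))"
  by (simp add: fixpts_def Int_def)

lemma card_fixpts_Diff:
  "finite Y \<Longrightarrow> y \<in> Y \<Longrightarrow> real (card (fixpts P Y - {y})) = real (card (fixpts P Y)) - of_bool (P y = y)"
  using card.remove[of "fixpts P Y" y] by (cases "P y = y") (auto simp: fixpts_def)

lemma card_fixpts_le: "bicoloured k P X Y \<Longrightarrow> real (card (fixpts P Y)) \<le> real k"
  using card_mono[of Y "fixpts P Y"] by (auto simp: bicoloured_def fixpts_def)

text \<open>
  Of the \<open>Suc k\<close> outcomes, each fixed point of \<open>Y\<close> is removed by one, and at most one creates a new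
  fixed point.
\<close>

lemma sum_fixpts_glue_mixed:
  assumes a: "bicoloured (Suc k) P X Y" and r: "mixed_at P X Y x0 y0" and inner: "P y0 \<noteq> x0"
  shows "(\<Sum>y\<in>Y. real (card (fixpts (glue x0 y P) (Y - {y}))))
    \<le> real (Suc k) * real (card (fixpts P Y)) - real (card (fixpts P Y)) + 1"
proof -
  let ?v = "real (card (fixpts P Y))"
  have fin: "finite Y" and card: "card Y = Suc k" using a by (auto simp: bicoloured_def)
  have "real (card (fixpts (glue x0 y P) (Y - {y}))) \<le> ?v - of_bool (P y = y) + of_bool (P (P x0) = y)"
    if y: "y \<in> Y" for y
  proof -
    obtain x' where "fixpts (glue x0 y P) (Y - {y}) \<subseteq>
        (fixpts P Y - {y}) \<union> (if P (P x0) = y then {P x0} else {})"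
      using glue_mixed[OF a r inner y] .
    then have "card (fixpts (glue x0 y P) (Y - {y})) \<le>
        card ((fixpts P Y - {y}) \<union> (if P (P x0) = y then {P x0} else {}))"
      using fin by (intro card_mono) (auto simp: fixpts_def)
    also have "\<dots> \<le> card (fixpts P Y - {y}) + of_bool (P (P x0) = y)"
      by (rule order_trans[OF card_Un_le]) auto
    finally show ?thesis
      unfolding of_nat_le_iff[where 'a = real, symmetric] of_nat_add of_nat_of_bool
        card_fixpts_Diff[OF fin y] by simp
  qed
  then have "(\<Sum>y\<in>Y. real (card (fixpts (glue x0 y P) (Y - {y})))) \<le>
      (\<Sum>y\<in>Y. ?v - of_bool (P y = y) + of_bool (P (P x0) = y))"
    by (rule sum_mono)
  also have "\<dots> = real (Suc k) * ?v - ?v + (\<Sum>y\<in>Y. of_bool (P (P x0) = y))"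
    using sum_fixpts[OF fin, of P] card by (simp add: sum.distrib sum_subtractf)
  also have "(\<Sum>y\<in>Y. of_bool (P (P x0) = y)) \<le> (1 :: real)"
    by (rule sum_of_bool_le_1[OF fin]) auto
  finally show ?thesis by simp
qed

text \<open>
  Here the run in \<open>Y\<close> can be split off at both ends, so that two outcomes create a fixed point. If
  that run is the single point \<open>y0\<close>, an outcome which removes a fixed point turns \<open>y0\<close> into a fixed
  point; this is why no decrease is asserted.
\<close>

lemma sum_fixpts_glue_mixed_last:
  assumes a: "bicoloured (Suc k) P X Y" and r: "mixed_at P X Y x0 y0" and last: "P y0 = x0"
  shows "(\<Sum>y\<in>Y. real (card (fixpts (glue x0 y P) (Y - {y}))))
    \<le> real (Suc k) * real (card (fixpts P Y)) + 2"
proof -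
  let ?v = "real (card (fixpts P Y))"
  let ?B = "\<lambda>y. P y = y0 \<or> P y = y \<and> P x0 = y0"
  note e = bicoloured_eq[OF a]
  have fin: "finite Y" and card: "card Y = Suc k" using a by (auto simp: bicoloured_def)
  have nx: "x0 \<notin> Y" using r bicoloured_disj[OF a] by (auto simp: mixed_at_def)
  have "real (card (fixpts (glue x0 y P) (Y - {y}))) \<le>
      ?v - of_bool (P y = y) + of_bool (P (P x0) = y) + of_bool (?B y)"
    if y: "y \<in> Y" for y
  proof -
    have "card (fixpts (glue x0 y P) (Y - {y})) \<le> card ((fixpts P Y - {y}) \<union>
        (if P (P x0) = y then {P x0} else {}) \<union> (if ?B y then {y0} else {}))"
      using fin glue_mixed_last(3)[OF a r last y] by (intro card_mono) (auto simp: fixpts_def)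
    also have "\<dots> \<le> card ((fixpts P Y - {y}) \<union> (if P (P x0) = y then {P x0} else {})) + of_bool (?B y)"
      by (rule order_trans[OF card_Un_le]) auto
    also have "\<dots> \<le> card (fixpts P Y - {y}) + of_bool (P (P x0) = y) + of_bool (?B y)"
      by (intro add_right_mono order_trans[OF card_Un_le]) auto
    finally show ?thesis
      unfolding of_nat_le_iff[where 'a = real, symmetric] of_nat_add of_nat_of_bool
        card_fixpts_Diff[OF fin y] by simp
  qed
  then have "(\<Sum>y\<in>Y. real (card (fixpts (glue x0 y P) (Y - {y})))) \<le>
      (\<Sum>y\<in>Y. ?v - of_bool (P y = y) + of_bool (P (P x0) = y) + of_bool (?B y))"
    by (rule sum_mono)
  also have "\<dots> = real (Suc k) * ?v - ?v + (\<Sum>y\<in>Y. of_bool (P (P x0) = y)) + (\<Sum>y\<in>Y. of_bool (?B y))"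
    using sum_fixpts[OF fin, of P] card by (simp add: sum.distrib sum_subtractf)
  finally have "(\<Sum>y\<in>Y. real (card (fixpts (glue x0 y P) (Y - {y})))) \<le>
      real (Suc k) * ?v - ?v + (\<Sum>y\<in>Y. of_bool (P (P x0) = y)) + (\<Sum>y\<in>Y. of_bool (?B y))" .
  moreover have "(\<Sum>y\<in>Y. of_bool (P (P x0) = y)) + (\<Sum>y\<in>Y. of_bool (?B y)) \<le> ?v + 2"
  proof (cases "P x0 = y0")
    case True
    then have "?B y \<longleftrightarrow> P y = y" "P (P x0) \<noteq> y" if "y \<in> Y" for y
      using that e[of y x0] nx last by auto
    then have "(\<Sum>y\<in>Y. of_bool (P (P x0) = y)) = (0::real)" "(\<Sum>y\<in>Y. of_bool (?B y)) = ?v"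
      using sum_fixpts[OF fin, of P] by (simp_all cong: sum.cong)
    then show ?thesis by simp
  next
    case False
    have "(\<Sum>y\<in>Y. of_bool (P (P x0) = y)) \<le> (1 :: real)"
      by (rule sum_of_bool_le_1[OF fin]) auto
    moreover have "(\<Sum>y\<in>Y. of_bool (?B y)) \<le> (1 :: real)"
      using False e by (intro sum_of_bool_le_1[OF fin]) metis
    ultimately show ?thesis by linarith
  qed
  ultimately show ?thesis by linarith
qed

lemma mean_cycles_lower_last:
  assumes a: "bicoloured (Suc k) P X Y" and r: "mixed_at P X Y x0 y0" and last: "P y0 = x0" and B: "0 \<le> B"
    and next_step: "\<And>Q Y'. bicoloured k Q (X - {x0}) Y' \<Longrightarrow> pure Q (X - {x0}) Y' \<Longrightarrow>
      (\<And>u. u \<in> X - {x0} \<Longrightarrow> Q u = P u) \<Longrightarrow>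
      A - B * real (card (fixpts Q Y')) \<le> mean_cycles Q (X - {x0}) Y'"
  shows "2 / real (Suc k) + A - B * (real (card (fixpts P Y)) + 2 / real (Suc k)) \<le> mean_cycles P X Y"
proof (rule mean_cycles_ge[OF a])
  let ?v = "real (card (fixpts P Y))"
  have x0: "x0 \<in> X" "P x0 \<in> Y" and y0: "y0 \<in> Y" using r by (auto simp: mixed_at_def)
  show "x0 \<in> X" by fact
  show "2 \<le> (\<Sum>y\<in>Y. real (closings x0 y P))"
    using sum_closings_cases(4)[OF a x0 y0 last] by simp
  show "A - B * real (card (fixpts (glue x0 y P) (Y - {y}))) \<le>
      mean_cycles (glue x0 y P) (X - {x0}) (Y - {y})" if y: "y \<in> Y" for y
    using glue_mixed_last(1,2)[OF a r last y] by (intro next_step bicoloured_glue[OF a x0(1) y]) auto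
  have card: "card Y = Suc k" using a by (auto simp: bicoloured_def)
  have "B * (\<Sum>y\<in>Y. real (card (fixpts (glue x0 y P) (Y - {y})))) \<le> B * (real (Suc k) * ?v + 2)"
    using sum_fixpts_glue_mixed_last[OF a r last] B by (rule mult_left_mono)
  moreover
  have "K * (2 / K + A - B * (?v + 2 / K)) = 2 + K * A - B * (K * ?v + 2)"
    if "K \<noteq> 0" for K :: real
    using that by (simp add: field_simps)
  from this[of "real (Suc k)"]
  have "real (Suc k) * (2 / real (Suc k) + A - B * (?v + 2 / real (Suc k))) =
      2 + real (Suc k) * A - B * (real (Suc k) * ?v + 2)" by simp
  moreover have "(\<Sum>y\<in>Y. A - B * real (card (fixpts (glue x0 y P) (Y - {y})))) =
      real (Suc k) * A - B * (\<Sum>y\<in>Y. real (card (fixpts (glue x0 y P) (Y - {y}))))"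
    using card by (simp add: sum_subtractf sum_distrib_left)
  ultimately show "real (Suc k) * (2 / real (Suc k) + A - B * (?v + 2 / real (Suc k))) \<le>
      2 + (\<Sum>y\<in>Y. A - B * real (card (fixpts (glue x0 y P) (Y - {y}))))"
    by linarith
qed

text \<open>
  Every partner of the fixed point \<open>x0\<close> that lies in a cycle of length two leaves a new fixed point in
  \<open>Y\<close>, and all partners may be of this kind; therefore the number of fixed points is only bounded by
  one more than before. This does not hurt because such states are rare.
\<close>

lemma mean_cycles_lower_fixed:
  assumes a: "bicoloured (Suc k) P X Y" and p: "pure P X Y" and x0: "x0 \<in> X" "P x0 = x0" and B: "0 \<le> B"
    and next_step: "\<And>Q Y'. bicoloured k Q (X - {x0}) Y' \<Longrightarrow> pure Q (X - {x0}) Y' \<Longrightarrow>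
      (\<And>u. u \<in> X - {x0} \<Longrightarrow> Q u = P u) \<Longrightarrow>
      A - B * real (card (fixpts Q Y')) \<le> mean_cycles Q (X - {x0}) Y'"
  shows "real (card (fixpts P Y)) / real (Suc k) + A - B * (real (card (fixpts P Y)) + 1)
    \<le> mean_cycles P X Y"
proof (rule mean_cycles_ge[OF a])
  let ?v = "real (card (fixpts P Y))"
  show "x0 \<in> X" by fact
  show "?v \<le> (\<Sum>y\<in>Y. real (closings x0 y P))" using sum_closings_cases(2)[OF a x0] by simp
  have fin: "finite Y" and card: "card Y = Suc k" using a by (auto simp: bicoloured_def)
  show "A - B * (?v + 1) \<le> mean_cycles (glue x0 y P) (X - {x0}) (Y - {y})" if y: "y \<in> Y" for y
  proof -
    note g = glue_fixed_preserves[OF a x0 y]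
    have agree: "glue x0 y P u = P u" if "u \<in> X - {x0}" for u
      using that glue_fixed[OF a x0 y, of u] p y bicoloured_disj[OF a, of y] by (auto simp: pure_def)
    have "fixpts (glue x0 y P) (Y - {y}) \<subseteq> fixpts P Y \<union> {P y}"
      using g(4) by (auto simp: fixpts_def)
    then have "card (fixpts (glue x0 y P) (Y - {y})) \<le> card (fixpts P Y \<union> {P y})"
      using fin by (intro card_mono) (auto simp: fixpts_def)
    also have "\<dots> \<le> card (fixpts P Y) + 1" by (rule order_trans[OF card_Un_le]) auto
    finally have "B * real (card (fixpts (glue x0 y P) (Y - {y}))) \<le> B * (?v + 1)"
      using B by (intro mult_left_mono) auto
    moreover have "A - B * real (card (fixpts (glue x0 y P) (Y - {y}))) \<le>
        mean_cycles (glue x0 y P) (X - {x0}) (Y - {y})"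
      using g(3)[OF p] agree by (intro next_step bicoloured_glue[OF a x0(1) y]) auto
    ultimately show ?thesis by linarith
  qed
  have "K * (?v / K + A - B * (?v + 1)) = ?v + K * (A - B * (?v + 1))" if "K \<noteq> 0" for K :: real
    using that by (simp add: field_simps)
  from this[of "real (Suc k)"]
  show "real (Suc k) * (?v / real (Suc k) + A - B * (?v + 1)) \<le> ?v + (\<Sum>y\<in>Y. A - B * (?v + 1))"
    using card by simp
qed

section \<open>The lower bound: only cycles of length two on one side\<close>

text \<open>
  For even \<open>k\<close> the sum \<open>2 / k + 2 / (k - 2) + \<dots> + 2 / 2\<close> falls short of \<open>harm k\<close> by the sum of
  \<open>1 / (j * (j - 1))\<close> over all even \<open>j\<close> up to \<open>k\<close>. This closed form dominates it.
\<close>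

definition involution_loss :: "nat \<Rightarrow> real" where
  "involution_loss k = (if k = 0 then 0 else 3 / 4 - 1 / (2 * real k))"

lemma involution_loss_step:
  "1 / real (Suc j) - 1 / real (Suc (Suc j)) \<le> involution_loss (Suc (Suc j)) - involution_loss j"
proof (cases "j = 0")
  case False
  define x where "x = real j"
  have x: "0 < x" using False by (simp add: x_def)
  have "1 / (x + 1) - 1 / (x + 2) = 1 / ((x + 1) * (x + 2))"
    using x by (simp add: divide_simps)
  also have "\<dots> \<le> 1 / (x * (x + 2))"
    using x by (intro divide_left_mono mult_right_mono) auto
  also have "\<dots> = (3 / 4 - 1 / (2 * (x + 2))) - (3 / 4 - 1 / (2 * x))"
    using x by (simp add: divide_simps) (simp add: algebra_simps)
  finally show ?thesis using False by (simp add: involution_loss_def x_def add.commute)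
qed (simp add: involution_loss_def)

text \<open>
  One cycle \<open>{x, P x}\<close> is revealed in two steps. If the partner of \<open>x\<close> is not a fixed point, the second
  step completes \<open>2 / (k - 1)\<close> cycles in the mean; if it is one of the \<open>v\<close> fixed points, then \<open>P x\<close> has
  become a fixed point, and the second step completes a cycle exactly if it hits one of the \<open>v - 1\<close>
  remaining fixed points.
\<close>

lemma mean_cycles_lower_involution:
  assumes "bicoloured k P X Y" "pure P X Y" "\<And>x. x \<in> X \<Longrightarrow> P x \<noteq> x \<and> P (P x) = x"
  shows "harm k - involution_loss k \<le> mean_cycles P X Y"
  using assms
proof (induction k arbitrary: P X Y rule: less_induct)
  case (less K)
  note a = less.prems(1) and p = less.prems(2) and inv = less.prems(3)
  show ?case
  proof (cases "K = 0")
    case True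
    then show ?thesis using mean_cycles_nonneg[of P X Y] by (simp add: involution_loss_def harm_def)
  next
    case False
    then have "X \<noteq> {}" using a by (auto simp: bicoloured_def)
    then obtain x where x: "x \<in> X" by blast
    have Px: "P x \<in> X" "P x \<noteq> x" "P (P x) = x" using x p inv by (auto simp: pure_def)
    have "card {x, P x} \<le> card X" using x Px a by (intro card_mono) (auto simp: bicoloured_def)
    then have "2 \<le> K" using Px a by (simp add: bicoloured_def)
    then obtain j where K: "K = Suc (Suc j)" using le_Suc_ex[of 2 K] by auto
    note a = a[unfolded K]
    let ?v = "real (card (fixpts P Y))"
    define A where "A = harm j - involution_loss j"
    define m where "m y = A + 2 / real (Suc j) + of_bool (P y = y) * ((?v - 3) / real (Suc j))" for y
    have fin: "finite Y" and card: "card Y = Suc (Suc j)" using a by (auto simp: bicoloured_def)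
    have "m y \<le> mean_cycles (glue x y P) (X - {x}) (Y - {y})" if y: "y \<in> Y" for y
    proof -
      obtain x' y' where x': "x' \<in> X - {x}" "P x' = x"
        and agree: "\<And>u. u \<in> X - {x} - {x'} \<Longrightarrow> glue x y P u = P u"
        and r: "P y \<noteq> y \<Longrightarrow> mixed_at (glue x y P) (X - {x}) (Y - {y}) x' y' \<and> glue x y P y' = P x"
        and f: "P y = y \<Longrightarrow> pure (glue x y P) (X - {x}) (Y - {y}) \<and> glue x y P x' = P x"
        and v: "fixpts (glue x y P) (Y - {y}) = fixpts P Y - {y}"
        by (rule glue_pure[OF a p x Px(2) y]) blast
      have x'_eq: "x' = P x" using x' Px bicoloured_eq[OF a, of x' "P x"] by simp
      note a' = bicoloured_glue[OF a x y]
      have nxt: "A - 0 * real (card (fixpts Q Y')) \<le> mean_cycles Q (X - {x} - {x'}) Y'"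
        if Q: "bicoloured j Q (X - {x} - {x'}) Y'" "pure Q (X - {x} - {x'}) Y'"
          "\<And>u. u \<in> X - {x} - {x'} \<Longrightarrow> Q u = glue x y P u" for Q Y'
      proof -
        have QP: "Q u = P u" if "u \<in> X - {x} - {x'}" for u using that Q(3) agree by simp
        have inv': "Q u \<noteq> u \<and> Q (Q u) = u" if u: "u \<in> X - {x} - {x'}" for u
        proof -
          have "Q u \<in> X - {x} - {x'}" using Q(2) u by (auto simp: pure_def)
          then have "Q (Q u) = P (P u)" using QP u by metis
          then show ?thesis using QP[OF u] inv[of u] u by simp
        qed
        have "A \<le> mean_cycles Q (X - {x} - {x'}) Y'"
          unfolding A_def by (rule less.IH[OF _ Q(1,2) inv']) (simp add: K)
        then show ?thesis by simp
      qed
      show ?thesis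
      proof (cases "P y = y")
        case True
        have "real (card (fixpts (glue x y P) (Y - {y}))) / real (Suc j) + A -
            0 * (real (card (fixpts (glue x y P) (Y - {y}))) + 1) \<le>
            mean_cycles (glue x y P) (X - {x}) (Y - {y})"
        proof (rule mean_cycles_lower_fixed[OF a' _ x'(1)])
          show "pure (glue x y P) (X - {x}) (Y - {y})" using f[OF True] by blast
          show "glue x y P x' = x'" using f[OF True] x'_eq by simp
        qed (simp, rule nxt)
        then have "real (card (fixpts P Y - {y})) / real (Suc j) + A \<le>
            mean_cycles (glue x y P) (X - {x}) (Y - {y})"
          unfolding v by simp
        then show ?thesis
          using True unfolding card_fixpts_Diff[OF fin y] m_def by (simp add: diff_divide_distrib)
      next
        case False
        have "2 / real (Suc j) + A - 0 * (real (card (fixpts (glue x y P) (Y - {y}))) + 2 / real (Suc j)) \<le>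
            mean_cycles (glue x y P) (X - {x}) (Y - {y})"
        proof (rule mean_cycles_lower_last[OF a'])
          show "mixed_at (glue x y P) (X - {x}) (Y - {y}) x' y'" using r[OF False] by blast
          show "glue x y P y' = x'" using r[OF False] x'_eq by simp
        qed (simp, rule nxt)
        then show ?thesis using False by (simp add: m_def add.commute)
      qed
    qed
    moreover have "real (Suc (Suc j)) * (harm K - involution_loss K) \<le> 0 + (\<Sum>y\<in>Y. m y)"
    proof -
      have "harm K - involution_loss K \<le> A + 2 / real (Suc (Suc j))"
        using involution_loss_step[of j]
        by (simp add: A_def K harm_Suc inverse_eq_divide del: of_nat_Suc)
      then have "real (Suc (Suc j)) * (harm K - involution_loss K) \<le>
          real (Suc (Suc j)) * (A + 2 / real (Suc (Suc j)))"
        by (rule mult_left_mono) simp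
      also have "\<dots> = real (Suc (Suc j)) * A + 2"
        by (simp add: distrib_left del: of_nat_Suc)
      also have "\<dots> \<le> real (Suc (Suc j)) * A + (2 * real (Suc (Suc j)) + ?v * (?v - 3)) / real (Suc j)"
      proof -
        \<comment> \<open>There is no integer strictly between 1 and 2.\<close>
        have "0 \<le> (?v - 1) * (?v - 2)"
          by (cases "card (fixpts P Y)"; cases "card (fixpts P Y) - 1") (auto simp: of_nat_diff)
        then have "2 * real (Suc j) \<le> 2 * real (Suc (Suc j)) + ?v * (?v - 3)"
          by (simp add: algebra_simps)
        then show ?thesis by (simp add: le_divide_eq del: of_nat_Suc)
      qed
      also have "\<dots> = (\<Sum>y\<in>Y. m y)"
      proof -
        have "(\<Sum>y\<in>Y. m y) = real (card Y) * (A + 2 / real (Suc j)) +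
            (\<Sum>y\<in>Y. of_bool (P y = y)) * ((?v - 3) / real (Suc j))"
          unfolding m_def sum.distrib sum_constant sum_distrib_right distrib_left by simp
        then show ?thesis
          unfolding sum_fixpts[OF fin] card by (simp add: distrib_left add_divide_distrib del: of_nat_Suc)
      qed
      finally show ?thesis by simp
    qed
    ultimately show ?thesis
      by (intro mean_cycles_ge[OF a x, where c = 0 and m = m] sum_nonneg) auto
  qed
qed

section \<open>The lower bound: the general case\<close>

text \<open>
  A mixed state with an \<open>X\<close>-run of length at least two is better by \<open>1 / k\<close> than a pure state, which is
  the amount that the pure state loses in its next step. The bound for mixed states with an \<open>X\<close>-run
  of length one or a fixed point in \<open>X\<close> is not part of the induction; these states are followed one
  step further, back to a pure state with two pairs less.
\<close>

lemma mean_cycles_lower: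
  assumes "bicoloured k P X Y" "\<And>x. x \<in> X \<Longrightarrow> P x \<noteq> x"
  shows "(pure P X Y \<longrightarrow> harm k - loss k (card (fixpts P Y)) \<le> mean_cycles P X Y) \<and>
    (\<forall>x0 y0. mixed_at P X Y x0 y0 \<and> P y0 \<noteq> x0 \<longrightarrow>
      harm k - loss k (card (fixpts P Y)) + 1 / real k \<le> mean_cycles P X Y)"
  using assms
proof (induction k arbitrary: P X Y rule: less_induct)
  case (less K)
  note a = less.prems(1) and nofix = less.prems(2)
  have IH_pure: "harm k - loss k (card (fixpts Q Y')) \<le> mean_cycles Q X' Y'"
    if "k < K" "bicoloured k Q X' Y'" "\<And>x. x \<in> X' \<Longrightarrow> Q x \<noteq> x" "pure Q X' Y'"
    for k Q and X' Y' :: "'a set" using less.IH[OF that(1,2,3)] that(4) by blast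
  have IH_run: "harm k - loss k (card (fixpts Q Y')) + 1 / real k \<le> mean_cycles Q X' Y'"
    if "k < K" "bicoloured k Q X' Y'" "\<And>x. x \<in> X' \<Longrightarrow> Q x \<noteq> x" "mixed_at Q X' Y' x0 y0" "Q y0 \<noteq> x0"
    for k Q x0 y0 and X' Y' :: "'a set" using less.IH[OF that(1,2,3)] that(4,5) by blast
  let ?v = "real (card (fixpts P Y))"
  have fin: "finite Y" using a by (simp add: bicoloured_def)
  have v: "0 \<le> ?v" "?v \<le> real K" using card_fixpts_le[OF a] by simp_all
  have two: "2 \<le> K" if "x \<in> X" "x' \<in> X" "x \<noteq> x'" for x x'
  proof -
    have "card {x, x'} \<le> card X" using that a by (intro card_mono) (auto simp: bicoloured_def)
    then show ?thesis using that a by (simp add: bicoloured_def)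
  qed
  have pure: "harm K - loss K ?v \<le> mean_cycles P X Y" if p: "pure P X Y"
  proof (cases "K = 0")
    case True
    then show ?thesis using mean_cycles_nonneg[of P X Y]
      by (simp add: loss_def loss_const_def loss_slope_def harm_def)
  next
    case K0: False
    show ?thesis
    proof (cases "\<forall>x\<in>X. P (P x) = x")
      case True
      then have "harm K - involution_loss K \<le> mean_cycles P X Y"
        using nofix by (intro mean_cycles_lower_involution[OF a p]) blast
      moreover have "involution_loss K \<le> loss K ?v"
      proof -
        obtain x where x: "x \<in> X" using K0 a by (metis bicoloured_def card.empty equals0I)
        then have "2 \<le> K" using p nofix[OF x] by (intro two[of x "P x"]) (auto simp: pure_def)
        then have "involution_loss K \<le> 3 / 4" "3 / 4 \<le> loss_const K"
          using weight_le[of K] by (auto simp: involution_loss_def loss_const_def)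
        moreover have "0 \<le> loss_slope K * ?v" using loss_slope_nonneg v by (intro mult_nonneg_nonneg)
        ultimately show ?thesis by (simp add: loss_def)
      qed
      ultimately show ?thesis by linarith
    next
      case False
      then obtain x where x: "x \<in> X" "P (P x) \<noteq> x" by blast
      have Px: "P x \<in> X" "P x \<noteq> x" using p x nofix by (auto simp: pure_def)
      obtain k where K: "K = Suc k" and k: "1 \<le> k"
        using two[OF x(1) Px(1)] Px(2) by (cases K) auto
      note a = a[unfolded K]
      have card: "card Y = Suc k" using a by (simp add: bicoloured_def)
      define m where "m y = harm k - loss k ?v + 1 / real k
        + of_bool (P y = y) * (loss_slope k - 1 / real k)" for y
      have "m y \<le> mean_cycles (glue x y P) (X - {x}) (Y - {y})" if y: "y \<in> Y" for y
      proof -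
        obtain x' y' where x': "x' \<in> X - {x}" "P x' = x"
          and agree: "\<And>u. u \<in> X - {x} - {x'} \<Longrightarrow> glue x y P u = P u"
          and r: "P y \<noteq> y \<Longrightarrow> mixed_at (glue x y P) (X - {x}) (Y - {y}) x' y' \<and> glue x y P y' = P x"
          and f: "P y = y \<Longrightarrow> pure (glue x y P) (X - {x}) (Y - {y}) \<and> glue x y P x' = P x"
          and fx: "fixpts (glue x y P) (Y - {y}) = fixpts P Y - {y}"
          by (rule glue_pure[OF a p x(1) Px(2) y]) blast
        note a' = bicoloured_glue[OF a x(1) y]
        have ne: "P x \<noteq> x'" using x(2) x'(2) by metis
        have "glue x y P x' \<noteq> x'"
        proof (cases "P y = y")
          case True
          then show ?thesis using f ne by simp
        next
          case False
          then have "glue x y P x' \<in> Y" using r by (auto simp: mixed_at_def)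
          then show ?thesis using bicoloured_disj[OF a, of x'] x' by auto
        qed
        then have nf: "glue x y P u \<noteq> u" if "u \<in> X - {x}" for u
          using agree[of u] nofix[of u] that by (cases "u = x'") auto
        have eq: "loss k (card (fixpts P Y - {y})) = loss k ?v - loss_slope k * of_bool (P y = y)"
          unfolding loss_def card_fixpts_Diff[OF fin y] by (simp only: right_diff_distrib add_diff_eq)
        show ?thesis
        proof (cases "P y = y")
          case True
          from IH_pure[OF _ a' nf, unfolded fx eq] f[OF True] K True
          show ?thesis by (simp add: m_def)
        next
          case False
          have "mixed_at (glue x y P) (X - {x}) (Y - {y}) x' y'" "glue x y P y' \<noteq> x'"
            using r[OF False] ne by auto
          from IH_run[OF _ a' nf this, unfolded fx eq] K False
          show ?thesis by (simp add: m_def)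
        qed
      qed
      moreover have "real (Suc k) * (harm (Suc k) - loss (Suc k) ?v) \<le> 0 + (\<Sum>y\<in>Y. m y)"
      proof -
        have "(\<Sum>y\<in>Y. m y) = real (Suc k) * (harm k - loss k ?v + 1 / real k)
            + ?v * (loss_slope k - 1 / real k)"
          unfolding m_def sum.distrib sum_distrib_right[symmetric] sum_fixpts[OF fin] using card
          by (simp add: distrib_left del: of_nat_Suc)
        also have "\<dots> = real (Suc k) * harm k + 1 - (real (Suc k) * loss_const k +
            loss_slope k * (real (Suc k) * ?v - ?v) + (?v - 1) / real k)"
          using k by (simp add: loss_def field_simps)
        finally have "(\<Sum>y\<in>Y. m y) \<ge> real (Suc k) * harm k + 1 - real (Suc k) * loss (Suc k) ?v"
          using loss_pure_step[OF k v(1) v(2)[unfolded K]] by linarith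
        moreover have "real (Suc k) * (harm (Suc k) - loss (Suc k) ?v) =
            real (Suc k) * harm k + 1 - real (Suc k) * loss (Suc k) ?v"
          by (simp add: harm_Suc right_diff_distrib distrib_left del: of_nat_Suc)
        ultimately show ?thesis by linarith
      qed
      ultimately show ?thesis
        unfolding K by (intro mean_cycles_ge[OF a x(1), where c = 0 and m = m] sum_nonneg) auto
    qed
  qed
  have "harm K - loss K ?v + 1 / real K \<le> mean_cycles P X Y"
    if r: "mixed_at P X Y x0 y0" and inner: "P y0 \<noteq> x0" for x0 y0
  proof -
    have x0: "x0 \<in> X" "P x0 \<in> Y" and y0: "y0 \<in> Y" "P y0 \<in> X" using r by (auto simp: mixed_at_def)
    obtain k where K: "K = Suc k" and k: "1 \<le> k"
      using two[OF x0(1) y0(2)] inner by (cases K) auto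
    note a = a[unfolded K]
    have card: "card Y = Suc k" using a by (simp add: bicoloured_def)
    have c: "(\<Sum>y\<in>Y. real (closings x0 y P)) = 1"
      using sum_closings_cases(3)[OF a x0] mixed_at_inner[OF a r inner] by blast
    define V where "V y = real (card (fixpts (glue x0 y P) (Y - {y})))" for y
    have V: "(\<Sum>y\<in>Y. V y) \<le> real (Suc k) * ?v - ?v + 1"
      using sum_fixpts_glue_mixed[OF a r inner] by (simp add: V_def)
    have sum_y0: "(\<Sum>y\<in>Y. of_bool (y = y0)) = (1 :: real)"
      using fin y0(1) by (simp add: of_bool_def)
    show ?thesis
    proof (cases "P (P y0) = x0")
      case False
      \<comment> \<open>The mixed_at in \<open>X\<close> has length at least three, so what remains of it has length at least two.\<close>
      define m where "m y = harm k - loss_const k + 1 / real k - loss_slope k * V y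
        - of_bool (y = y0) * (1 / real k)" for y
      have "m y \<le> mean_cycles (glue x0 y P) (X - {x0}) (Y - {y})" if y: "y \<in> Y" for y
      proof -
        obtain x' where x': "x' \<in> X - {x0}" "P x' = x0"
          and agree: "\<And>u. u \<in> X - {x0} - {x'} \<Longrightarrow> glue x0 y P u = P u"
          and r': "y \<noteq> y0 \<Longrightarrow> mixed_at (glue x0 y P) (X - {x0}) (Y - {y}) x' y0 \<and> glue x0 y P y0 = P y0"
          and f: "y = y0 \<Longrightarrow> pure (glue x0 y P) (X - {x0}) (Y - {y}) \<and> glue x0 y P x' = P y0"
          using glue_mixed[OF a r inner y] by metis
        note a' = bicoloured_glue[OF a x0(1) y]
        have ne: "P y0 \<noteq> x'" using False x'(2) by metis
        have "glue x0 y P x' \<noteq> x'"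
        proof (cases "y = y0")
          case True
          then show ?thesis using f ne by simp
        next
          case False
          then have "glue x0 y P x' \<in> Y" using r' by (auto simp: mixed_at_def)
          then show ?thesis using bicoloured_disj[OF a, of x'] x' by auto
        qed
        then have nf: "glue x0 y P u \<noteq> u" if "u \<in> X - {x0}" for u
          using agree[of u] nofix[of u] that by (cases "u = x'") auto
        show ?thesis
        proof (cases "y = y0")
          case True
          from IH_pure[OF _ a' nf] f[OF True] K True
          show ?thesis by (simp add: m_def loss_def V_def)
        next
          case False
          have "mixed_at (glue x0 y P) (X - {x0}) (Y - {y}) x' y0" "glue x0 y P y0 \<noteq> x'"
            using r'[OF False] ne by auto
          from IH_run[OF _ a' nf this] K False
          show ?thesis by (simp add: m_def loss_def V_def)
        qed
      qed
      moreover have "real (Suc k) * (harm (Suc k) - loss (Suc k) ?v + 1 / real (Suc k)) \<le> 1 + (\<Sum>y\<in>Y. m y)"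
      proof -
        have "(\<Sum>y\<in>Y. m y) = real (Suc k) * (harm k - loss_const k + 1 / real k)
            - loss_slope k * (\<Sum>y\<in>Y. V y) - 1 / real k"
          unfolding m_def sum_subtractf sum_distrib_right[symmetric] sum_distrib_left[symmetric] sum_y0
          using card by (simp del: of_nat_Suc)
        also have "\<dots> = real (Suc k) * harm k + 1 - real (Suc k) * loss_const k
            - loss_slope k * (\<Sum>y\<in>Y. V y)"
          using k by (simp add: field_simps)
        finally have "(\<Sum>y\<in>Y. m y) = real (Suc k) * harm k + 1 - real (Suc k) * loss_const k
            - loss_slope k * (\<Sum>y\<in>Y. V y)" .
        moreover have "loss_slope k * (\<Sum>y\<in>Y. V y) \<le> loss_slope k * (real (Suc k) * ?v + 1 - ?v)"
          using V by (intro mult_left_mono loss_slope_nonneg) linarith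
        moreover note loss_mixed_step[OF k v(1)]
        moreover have "real (Suc k) * (harm (Suc k) - loss (Suc k) ?v + 1 / real (Suc k)) =
            real (Suc k) * harm k + 2 - real (Suc k) * loss (Suc k) ?v"
          by (simp add: harm_Suc right_diff_distrib distrib_left del: of_nat_Suc)
        ultimately show ?thesis by linarith
      qed
      ultimately show ?thesis
        unfolding K using c by (intro mean_cycles_ge[OF a x0(1), where c = 1 and m = m]) auto
    next
      case True
      \<comment> \<open>The mixed_at in \<open>X\<close> has length two. What remains of it is the single point \<open>P y0\<close>, either as a mixed_at of
        length one or, for the partner \<open>y0\<close>, as a fixed point.\<close>
      obtain j where kj: "k = Suc j" using k by (cases k) auto
      define A where "A = harm j - loss_const j"
      define B where "B = loss_slope j"
      have B: "0 \<le> B" unfolding B_def by (rule loss_slope_nonneg)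
      define m where "m y = A + 2 / real k - 2 * B / real k - B * V y
        - of_bool (y = y0) * (2 / real k - 2 * B / real k + B)" for y
      have "m y \<le> mean_cycles (glue x0 y P) (X - {x0}) (Y - {y})" if y: "y \<in> Y" for y
      proof -
        obtain x' where x': "x' \<in> X - {x0}" "P x' = x0"
          and agree: "\<And>u. u \<in> X - {x0} - {x'} \<Longrightarrow> glue x0 y P u = P u"
          and r': "y \<noteq> y0 \<Longrightarrow> mixed_at (glue x0 y P) (X - {x0}) (Y - {y}) x' y0 \<and> glue x0 y P y0 = P y0"
          and f: "y = y0 \<Longrightarrow> pure (glue x0 y P) (X - {x0}) (Y - {y}) \<and> glue x0 y P x' = P y0"
          using glue_mixed[OF a r inner y] by metis
        note a' = bicoloured_glue[OF a x0(1) y, unfolded kj]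
        have x'_eq: "x' = P y0" using True x'(2) bicoloured_eq[OF a, of x' "P y0"] by simp
        have nxt: "A - B * real (card (fixpts Q Y')) \<le> mean_cycles Q (X - {x0} - {x'}) Y'"
          if Q: "bicoloured j Q (X - {x0} - {x'}) Y'" "pure Q (X - {x0} - {x'}) Y'"
            "\<And>u. u \<in> X - {x0} - {x'} \<Longrightarrow> Q u = glue x0 y P u" for Q Y'
        proof -
          have "Q u \<noteq> u" if "u \<in> X - {x0} - {x'}" for u
            using that Q(3)[OF that] agree[OF that] nofix[of u] by auto
          from IH_pure[OF _ Q(1) this Q(2)] show ?thesis
            by (simp add: K kj A_def B_def loss_def)
        qed
        show ?thesis
        proof (cases "y = y0")
          case True
          have "V y / real (Suc j) + A - B * (V y + 1) \<le> mean_cycles (glue x0 y P) (X - {x0}) (Y - {y})"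
            unfolding V_def
          proof (rule mean_cycles_lower_fixed[OF a' _ x'(1) _ B])
            show "pure (glue x0 y P) (X - {x0}) (Y - {y})" using f[OF True] by blast
            show "glue x0 y P x' = x'" using f[OF True] x'_eq by simp
          qed (rule nxt)
          moreover have "0 \<le> V y / real (Suc j)" by (simp add: V_def)
          ultimately show ?thesis using True by (simp add: m_def distrib_left)
        next
          case False
          have "2 / real (Suc j) + A - B * (V y + 2 / real (Suc j)) \<le>
              mean_cycles (glue x0 y P) (X - {x0}) (Y - {y})"
            unfolding V_def
          proof (rule mean_cycles_lower_last[OF a' _ _ B])
            show "mixed_at (glue x0 y P) (X - {x0}) (Y - {y}) x' y0" using r'[OF False] by blast
            show "glue x0 y P y0 = x'" using r'[OF False] x'_eq by simp
          qed (rule nxt)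
          then show ?thesis using False by (simp add: m_def kj distrib_left mult.commute[of B 2])
        qed
      qed
      moreover have "real (Suc k) * (harm (Suc k) - loss (Suc k) ?v + 1 / real (Suc k)) \<le> 1 + (\<Sum>y\<in>Y. m y)"
      proof -
        have "(\<Sum>y\<in>Y. m y) = real (Suc k) * (A + 2 / real k - 2 * B / real k) - B * (\<Sum>y\<in>Y. V y)
            - (2 / real k - 2 * B / real k + B)"
          unfolding m_def sum_subtractf sum_distrib_right[symmetric] sum_distrib_left[symmetric] sum_y0
          using card by (simp add: sum.distrib sum_subtractf right_diff_distrib distrib_left del: of_nat_Suc)
        also have "\<dots> = real (Suc k) * A + 2 - 3 * B - B * (\<Sum>y\<in>Y. V y)"
          using k by (simp add: field_simps)
        finally have 1: "(\<Sum>y\<in>Y. m y) = real (Suc k) * A + 2 - 3 * B - B * (\<Sum>y\<in>Y. V y)" .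
        have 2: "B * (\<Sum>y\<in>Y. V y) \<le> B * (real (Suc k) * ?v + 4 - ?v) - 3 * B"
          using mult_left_mono[OF V B] by (simp add: algebra_simps)
        have 3: "real (Suc k) * loss_const j + B * (real (Suc k) * ?v + 4 - ?v) + 1 / real k
            \<le> real (Suc k) * loss (Suc k) ?v"
          using loss_double_step[of ?v j] v unfolding K kj B_def by blast
        have 4: "real (Suc k) * (harm (Suc k) - loss (Suc k) ?v + 1 / real (Suc k)) =
            real (Suc k) * harm k + 2 - real (Suc k) * loss (Suc k) ?v"
          by (simp add: harm_Suc right_diff_distrib distrib_left del: of_nat_Suc)
        have 5: "real (Suc k) * harm k = real (Suc k) * harm j + 1 + 1 / real k"
          using k unfolding kj harm_Suc by (simp add: field_simps)
        have 6: "real (Suc k) * A = real (Suc k) * harm j - real (Suc k) * loss_const j"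
          unfolding A_def by (rule right_diff_distrib)
        show ?thesis using 1 2 3 4 5 6 by linarith
      qed
      ultimately show ?thesis
        unfolding K using c by (intro mean_cycles_ge[OF a x0(1), where c = 1 and m = m]) auto
    qed
  qed
  with pure show ?case by blast
qed

section \<open>Conjugacy classes and matchings\<close>

lemma orbit_conjugate:
  assumes "\<And>x. x \<in> A \<Longrightarrow> F (h x) = h (f x)" "\<And>x. x \<in> A \<Longrightarrow> f x \<in> A" "x \<in> A"
  shows "orbit F (h x) = h ` orbit f x" "orbit f x \<subseteq> A"
proof -
  show sub: "orbit f x \<subseteq> A"
  proof
    fix y assume "y \<in> orbit f x"
    then show "y \<in> A" by induction (use assms in auto)
  qed
  show "orbit F (h x) = h ` orbit f x"
  proof
    show "orbit F (h x) \<subseteq> h ` orbit f x"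
    proof
      fix y assume "y \<in> orbit F (h x)"
      then show "y \<in> h ` orbit f x"
      proof induction
        case base
        show ?case using assms by (auto intro: orbit.base)
      next
        case (step y)
        then show ?case using assms(1) sub orbit.step[of _ f x] by fastforce
      qed
    qed
    have "h y \<in> orbit F (h x)" if "y \<in> orbit f x" for y
      using that
    proof induction
      case base
      show ?case using orbit.base[of F "h x"] assms by simp
    next
      case (step y)
      then have "F (h y) = h (f y)" using assms(1) sub by blast
      then show ?case using orbit.step[OF step.IH] by simp
    qed
    then show "h ` orbit f x \<subseteq> orbit F (h x)" by auto
  qed
qed

lemma ncyc_conjugate:
  assumes "\<And>x. x \<in> A \<Longrightarrow> F (h x) = h (f x)" "\<And>x. x \<in> A \<Longrightarrow> f x \<in> A" "inj_on h A"
  shows "ncyc F (h ` A) = ncyc f A"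
proof -
  have "orbit F ` h ` A = (`) h ` orbit f ` A"
    using orbit_conjugate(1)[of A F h f, OF assms(1,2)] by (auto simp: image_image)
  moreover have "inj_on ((`) h) (orbit f ` A)"
    using orbit_conjugate(2)[of A F h f, OF assms(1,2)] assms(3)
    by (intro inj_on_subset[OF inj_on_image_Pow[OF assms(3)]]) auto
  ultimately show ?thesis by (simp add: ncyc_def card_image)
qed

text \<open>A cycle which alternates between \<open>X\<close> and \<open>Y\<close> meets \<open>X\<close> in exactly one cycle of the square.\<close>

lemma ncyc_alternating:
  assumes R: "R permutes X \<union> Y" and fin: "finite (X \<union> Y)" and disj: "X \<inter> Y = {}"
    and XY: "\<And>x. x \<in> X \<Longrightarrow> R x \<in> Y" and YX: "\<And>y. y \<in> Y \<Longrightarrow> R y \<in> X"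
  shows "ncyc R (X \<union> Y) = ncyc (R \<circ> R) X"
proof -
  have perm: "permutation R" using R fin by (auto simp: permutation_permutes)
  have self: "z \<in> orbit R z" for z by (rule permutation_self_in_orbit[OF perm])
  have eq: "orbit R z = orbit R z'" if "z \<in> orbit R z'" for z z'
    by (rule orbit_cyclic_eq3[OF cyclic_on_orbit'[OF perm] that])
  define S where "S = R \<circ> R"
  have S_apply: "S z = R (R z)" for z by (simp add: S_def)
  have sq: "orbit S z = orbit R z \<inter> X" if z: "z \<in> X" for z
  proof
    show "orbit S z \<subseteq> orbit R z \<inter> X"
    proof
      fix y assume "y \<in> orbit S z"
      then show "y \<in> orbit R z \<inter> X"
        proof induction
        case base
        show ?case using z XY YX by (auto simp: S_apply[of z] intro: orbit.intros)
      next
        case (step y)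
        then show ?case using XY YX by (auto simp: S_apply[of y] intro: orbit.intros)
      qed
    qed
    have "(if y \<in> X then y else R y) \<in> orbit S z" if "y \<in> orbit R z" for y
      using that
    proof induction
      case base
      have "R z \<notin> X" using XY[OF z] disj by auto
      then show ?case using orbit.base[of S z] by (simp add: S_apply[of z])
    next
      case (step y)
      have "y \<in> X \<union> Y" using permutes_orbit_subset[OF R, of z] step.hyps z by auto
      then consider "y \<in> X" "R y \<notin> X" | "y \<notin> X" "R y \<in> X" using XY YX disj by blast
      then show ?case
        using step.IH orbit.step[of y S z] by cases (auto simp: S_apply[of y])
    qed
    then show "orbit R z \<inter> X \<subseteq> orbit S z" by force
  qed
  have "orbit R y \<in> orbit R ` X" if "y \<in> Y" for y
    using eq[OF orbit.base[of R y]] YX[OF that] by auto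
  then have "orbit R ` (X \<union> Y) = orbit R ` X" by auto
  moreover have "orbit S ` X = (\<lambda>C. C \<inter> X) ` orbit R ` X"
    using sq by (auto simp: image_image)
  moreover have "inj_on (\<lambda>C. C \<inter> X) (orbit R ` X)"
  proof (rule inj_onI)
    fix C C' assume "C \<in> orbit R ` X" "C' \<in> orbit R ` X" "C \<inter> X = C' \<inter> X"
    then obtain z z' where z: "C = orbit R z" "C' = orbit R z'" "z \<in> X"
      and "orbit R z \<inter> X = orbit R z' \<inter> X" by blast
    then have "z \<in> orbit R z'" using self[of z] by blast
    then show "C = C'" unfolding z by (rule eq)
  qed
  ultimately show ?thesis unfolding S_def[symmetric] by (simp add: ncyc_def card_image)
qed

lemma cycles_conv_ncyc: "card (cycles n \<sigma>) = ncyc \<sigma> {1..n}"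
  by (simp add: cycles_def ncyc_def)

definition side_by_side :: "(nat \<Rightarrow> nat) \<Rightarrow> (nat \<Rightarrow> nat) \<Rightarrow> nat + nat \<Rightarrow> nat + nat" where
  "side_by_side \<sigma> \<omega> = map_sum \<sigma> \<omega>"

definition match_along :: "nat \<Rightarrow> (nat \<Rightarrow> nat) \<Rightarrow> nat + nat \<Rightarrow> nat + nat" where
  "match_along n \<pi> z = (case z of
     Inl x \<Rightarrow> if x \<in> {1..n} then Inr (\<pi> x) else z
   | Inr y \<Rightarrow> if y \<in> {1..n} then Inl (inv \<pi> y) else z)"

lemma involution_permutes:
  assumes "\<And>z. \<tau> (\<tau> z) = z" "\<And>z. z \<notin> Z \<Longrightarrow> \<tau> z = z"
  shows "\<tau> permutes Z"
  unfolding permutes_def using assms by metis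

lemma match_along_matching:
  assumes \<pi>: "\<pi> permutes {1..n}"
  shows "match_along n \<pi> \<in> matchings (Inl ` {1..n}) (Inr ` {1..n})"
proof -
  have in1: "\<pi> x \<in> {1..n} \<longleftrightarrow> x \<in> {1..n}" for x by (rule permutes_in_image[OF \<pi>])
  have in2: "inv \<pi> x \<in> {1..n} \<longleftrightarrow> x \<in> {1..n}" for x by (rule permutes_in_image[OF permutes_inv[OF \<pi>]])
  have inv: "match_along n \<pi> (match_along n \<pi> z) = z" for z
    using in1 in2 permutes_inverses[OF \<pi>] by (auto simp: match_along_def split: sum.split)
  have "match_along n \<pi> z = z" if "z \<notin> Inl ` {1..n} \<union> Inr ` {1..n}" for z
    using that by (auto simp: match_along_def split: sum.split)
  with inv have "match_along n \<pi> permutes Inl ` {1..n} \<union> Inr ` {1..n}"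
    by (rule involution_permutes)
  then show ?thesis using inv in1 in2 unfolding matchings_def
    by (auto simp: match_along_def simp del: atLeastAtMost_iff)
qed

lemma bij_betw_match_along:
  "bij_betw (match_along n) {\<pi>. \<pi> permutes {1..n}} (matchings (Inl ` {1..n}) (Inr ` {1..n}))"
proof -
  have "inj_on (match_along n) {\<pi>. \<pi> permutes {1..n}}"
  proof (rule inj_onI, clarsimp)
    fix \<pi> \<rho> assume p: "\<pi> permutes {Suc 0..n}" "\<rho> permutes {Suc 0..n}" and eq: "match_along n \<pi> = match_along n \<rho>"
    show "\<pi> = \<rho>"
    proof
      fix x show "\<pi> x = \<rho> x"
      proof (cases "x \<in> {1..n}")
        case True
        then show ?thesis using fun_cong[OF eq, of "Inl x"] by (simp add: match_along_def)
      next
        case False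
        then show ?thesis using p by (simp add: permutes_not_in)
      qed
    qed
  qed
  moreover have "card {\<pi>. \<pi> permutes {1..n}} = card (matchings (Inl ` {1..n}) (Inr ` {1..n} :: (nat + nat) set))"
    by (subst card_matchings) (auto simp: card_image card_permutations)
  moreover have "match_along n ` {\<pi>. \<pi> permutes {1..n}} \<subseteq> matchings (Inl ` {1..n}) (Inr ` {1..n})"
    using match_along_matching by auto
  ultimately show ?thesis
    unfolding bij_betw_def
    by (metis card_image card_subset_eq finite_matchings finite_imageI finite_atLeastAtMost)
qed

lemma bicoloured_side_by_side:
  assumes "\<sigma> permutes {1..n}" "\<omega> permutes {1..n}"
  shows "bicoloured n (side_by_side \<sigma> \<omega>) (Inl ` {1..n}) (Inr ` {1..n})"
proof -
  let ?Z = "Inl ` {1..n} \<union> Inr ` {1..n} :: (nat + nat) set"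
  have "inj (side_by_side \<sigma> \<omega>)"
    unfolding side_by_side_def using assms by (intro sum.inj_map permutes_inj)
  then have "inj_on (side_by_side \<sigma> \<omega>) ?Z" by (rule inj_on_subset) simp
  moreover have "side_by_side \<sigma> \<omega> ` ?Z \<subseteq> ?Z"
    using permutes_in_image[OF assms(1)] permutes_in_image[OF assms(2)]
    by (auto simp: side_by_side_def simp del: atLeastAtMost_iff)
  ultimately have "bij_betw (side_by_side \<sigma> \<omega>) ?Z ?Z"
    unfolding bij_betw_def by (intro conjI endo_inj_surj) auto
  then have "side_by_side \<sigma> \<omega> permutes ?Z"
  proof (rule bij_imp_permutes)
    show "side_by_side \<sigma> \<omega> z = z" if "z \<notin> ?Z" for z
      using that permutes_not_in[OF assms(1)] permutes_not_in[OF assms(2)]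
      by (cases z) (auto simp: side_by_side_def image_iff simp del: atLeastAtMost_iff)
  qed
  then show ?thesis by (auto simp: bicoloured_def card_image)
qed

lemma ncyc_side_by_side:
  assumes \<sigma>: "\<sigma> permutes {1..n}" and \<omega>: "\<omega> permutes {1..n}" and \<pi>: "\<pi> permutes {1..n}"
  shows "ncyc (side_by_side \<sigma> \<omega> \<circ> match_along n \<pi>) (Inl ` {1..n} \<union> Inr ` {1..n}) =
    ncyc (\<sigma> \<circ> (inv \<pi> \<circ> \<omega> \<circ> \<pi>)) {1..n}"
proof -
  let ?R = "side_by_side \<sigma> \<omega> \<circ> match_along n \<pi>"
  note im = permutes_in_image[OF \<sigma>] permutes_in_image[OF \<omega>] permutes_in_image[OF \<pi>]
    permutes_in_image[OF permutes_inv[OF \<pi>]]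
  have "match_along n \<pi> permutes Inl ` {1..n} \<union> Inr ` {1..n}"
    using match_along_matching[OF \<pi>] by (auto simp: matchings_def)
  moreover have "side_by_side \<sigma> \<omega> permutes Inl ` {1..n} \<union> Inr ` {1..n}"
    using bicoloured_side_by_side[OF \<sigma> \<omega>] by (simp add: bicoloured_def)
  ultimately have "?R permutes Inl ` {1..n} \<union> Inr ` {1..n}" by (rule permutes_compose)
  then have "ncyc ?R (Inl ` {1..n} \<union> Inr ` {1..n}) = ncyc (?R \<circ> ?R) (Inl ` {1..n})"
    by (rule ncyc_alternating) (use im in \<open>auto simp: match_along_def side_by_side_def simp del: atLeastAtMost_iff\<close>)
  also have "\<dots> = ncyc (\<sigma> \<circ> (inv \<pi> \<circ> \<omega> \<circ> \<pi>)) {1..n}"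
    by (rule ncyc_conjugate) (use im in \<open>auto simp: match_along_def side_by_side_def simp del: atLeastAtMost_iff\<close>)
  finally show ?thesis .
qed

lemma mean_cycles_side_by_side:
  assumes \<sigma>: "\<sigma> permutes {1..n}" and \<omega>: "\<omega> permutes {1..n}"
  shows "fact n * mean_cycles (side_by_side \<sigma> \<omega>) (Inl ` {1..n}) (Inr ` {1..n}) =
    (\<Sum>\<pi> | \<pi> permutes {1..n}. real (card (cycles n (\<sigma> \<circ> (inv \<pi> \<circ> \<omega> \<circ> \<pi>)))))"
proof -
  have "fact n * mean_cycles (side_by_side \<sigma> \<omega>) (Inl ` {1..n}) (Inr ` {1..n}) =
    (\<Sum>\<tau>\<in>matchings (Inl ` {1..n}) (Inr ` {1..n}).
      real (ncyc (side_by_side \<sigma> \<omega> \<circ> \<tau>) (Inl ` {1..n} \<union> Inr ` {1..n})))"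
    by (simp add: mean_cycles_def card_image)
  also have "\<dots> = (\<Sum>\<pi> | \<pi> permutes {1..n}.
      real (ncyc (side_by_side \<sigma> \<omega> \<circ> match_along n \<pi>) (Inl ` {1..n} \<union> Inr ` {1..n})))"
    by (rule sum.reindex_bij_betw[OF bij_betw_match_along, symmetric])
  also have "\<dots> = (\<Sum>\<pi> | \<pi> permutes {1..n}. real (card (cycles n (\<sigma> \<circ> (inv \<pi> \<circ> \<omega> \<circ> \<pi>)))))"
    by (rule sum.cong[OF refl]) (simp only: mem_Collect_eq ncyc_side_by_side[OF \<sigma> \<omega>] cycles_conv_ncyc)
  finally show ?thesis .
qed

lemma cycle_type_conjugate:
  assumes \<omega>: "\<omega> permutes {1..n}" and \<rho>: "\<rho> permutes {1..n}"
  shows "cycle_type n (\<rho> \<circ> \<omega> \<circ> inv \<rho>) = cycle_type n \<omega>"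
proof -
  have conj: "(\<rho> \<circ> \<omega> \<circ> inv \<rho>) (\<rho> x) = \<rho> (\<omega> x)" for x
    using permutes_inverses[OF \<rho>] by simp
  have orb: "orbit (\<rho> \<circ> \<omega> \<circ> inv \<rho>) (\<rho> x) = \<rho> ` orbit \<omega> x" for x
    by (rule orbit_conjugate(1)[where A = UNIV]) (use conj in auto)
  have "cycles n (\<rho> \<circ> \<omega> \<circ> inv \<rho>) = orbit (\<rho> \<circ> \<omega> \<circ> inv \<rho>) ` \<rho> ` {1..n}"
    unfolding cycles_def permutes_image[OF \<rho>] ..
  also have "\<dots> = (`) \<rho> ` cycles n \<omega>" by (simp add: cycles_def image_image orb)
  finally have cyc: "cycles n (\<rho> \<circ> \<omega> \<circ> inv \<rho>) = (`) \<rho> ` cycles n \<omega>" .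
  have inj: "inj \<rho>" by (rule permutes_inj[OF \<rho>])
  have "image_mset card (mset_set ((`) \<rho> ` cycles n \<omega>)) = image_mset card (image_mset ((`) \<rho>) (mset_set (cycles n \<omega>)))"
    using image_mset_mset_set[OF inj_on_image[OF inj_on_subset[OF inj subset_UNIV]], of "cycles n \<omega>"]
    by simp
  also have "\<dots> = image_mset card (mset_set (cycles n \<omega>))"
    using inj by (simp add: image_mset.compositionality comp_def card_image inj_on_subset)
  finally show ?thesis by (simp add: cycle_type_def cyc)
qed

lemma sum_conj_class_conjugate:
  assumes \<pi>: "\<pi> permutes {1..n}"
  shows "(\<Sum>\<omega>\<in>conj_class n \<beta>. f (inv \<pi> \<circ> \<omega> \<circ> \<pi>)) = (\<Sum>\<omega>\<in>conj_class n \<beta>. f \<omega>)"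
proof -
  have closed: "\<rho> \<circ> \<omega> \<circ> inv \<rho> \<in> conj_class n \<beta>" if "\<rho> permutes {1..n}" "\<omega> \<in> conj_class n \<beta>" for \<rho> \<omega>
    using that by (auto simp: conj_class_def cycle_type_conjugate intro!: permutes_compose permutes_inv)
  note pi = permutes_inv[OF \<pi>] permutes_inv_o[OF \<pi>] permutes_inv_inv[OF \<pi>]
  show ?thesis
  proof (rule sum.reindex_bij_witness[of _ "\<lambda>\<omega>. \<pi> \<circ> \<omega> \<circ> inv \<pi>" "\<lambda>\<omega>. inv \<pi> \<circ> \<omega> \<circ> \<pi>"])
    fix \<omega> assume \<omega>: "\<omega> \<in> conj_class n \<beta>"
    show "inv \<pi> \<circ> \<omega> \<circ> \<pi> \<in> conj_class n \<beta>" using closed[OF pi(1) \<omega>] by (simp add: pi)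
    show "\<pi> \<circ> \<omega> \<circ> inv \<pi> \<in> conj_class n \<beta>" using closed[OF \<pi> \<omega>] .
    show "\<pi> \<circ> (inv \<pi> \<circ> \<omega> \<circ> \<pi>) \<circ> inv \<pi> = \<omega>" "inv \<pi> \<circ> (\<pi> \<circ> \<omega> \<circ> inv \<pi>) \<circ> \<pi> = \<omega>"
      using permutes_inverses[OF \<pi>] by (auto simp: fun_eq_iff)
  qed simp
qed

text \<open>
  Averaging over a conjugacy class is the same as averaging over the class and over a further
  conjugation.
\<close>

lemma sum_cycles_conj_class:
  assumes \<sigma>: "\<sigma> permutes {1..n}"
  shows "(\<Sum>\<omega>\<in>conj_class n \<beta>. real (card (cycles n (\<sigma> \<circ> \<omega>)))) =
    (\<Sum>\<omega>\<in>conj_class n \<beta>. mean_cycles (side_by_side \<sigma> \<omega>) (Inl ` {1..n}) (Inr ` {1..n}))"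
proof -
  let ?c = "\<lambda>\<omega>. real (card (cycles n (\<sigma> \<circ> \<omega>)))"
  have "fact n * (\<Sum>\<omega>\<in>conj_class n \<beta>. ?c \<omega>) = (\<Sum>\<pi> | \<pi> permutes {1..n}. \<Sum>\<omega>\<in>conj_class n \<beta>. ?c \<omega>)"
    by (simp add: card_permutations)
  also have "\<dots> = (\<Sum>\<pi> | \<pi> permutes {1..n}. \<Sum>\<omega>\<in>conj_class n \<beta>. ?c (inv \<pi> \<circ> \<omega> \<circ> \<pi>))"
    by (rule sum.cong[OF refl]) (simp only: mem_Collect_eq sum_conj_class_conjugate[where f = ?c])
  also have "\<dots> = (\<Sum>\<omega>\<in>conj_class n \<beta>. \<Sum>\<pi> | \<pi> permutes {1..n}. ?c (inv \<pi> \<circ> \<omega> \<circ> \<pi>))"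
    by (rule sum.swap)
  also have "\<dots> = (\<Sum>\<omega>\<in>conj_class n \<beta>.
      fact n * mean_cycles (side_by_side \<sigma> \<omega>) (Inl ` {1..n}) (Inr ` {1..n}))"
    by (intro sum.cong[OF refl] mean_cycles_side_by_side[OF \<sigma>, symmetric])
      (auto simp: conj_class_def)
  finally show ?thesis by (simp flip: sum_distrib_left)
qed

lemma conj_class_no_fixpoint:
  assumes "1 \<notin> set \<alpha>" "\<sigma> \<in> conj_class n \<alpha>" "x \<in> {1..n}"
  shows "\<sigma> x \<noteq> x"
proof
  assume "\<sigma> x = x"
  then have "{x} \<in> cycles n \<sigma>"
    using assms(3) by (auto simp: cycles_def simp flip: orbit_eq_singleton_iff intro!: image_eqI[of _ _ x])
  moreover have "finite (cycles n \<sigma>)" by (simp add: cycles_def)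
  ultimately have "card {x} \<in> set (cycle_type n \<sigma>)"
    by (auto simp: cycle_type_def simp del: card.insert intro!: imageI)
  then show False using assms by (simp add: conj_class_def)
qed

lemma mean_cycles_bounds:
  assumes "0 < n" "1 \<notin> set \<alpha>" "\<sigma> \<in> conj_class n \<alpha>" "1 \<notin> set \<beta>" "\<omega> \<in> conj_class n \<beta>"
  shows "harm n - 3 + 6 * weight n \<le> mean_cycles (side_by_side \<sigma> \<omega>) (Inl ` {1..n}) (Inr ` {1..n})"
    and "mean_cycles (side_by_side \<sigma> \<omega>) (Inl ` {1..n}) (Inr ` {1..n}) \<le> harm n + 1"
proof -
  let ?P = "side_by_side \<sigma> \<omega>" and ?X = "Inl ` {1..n} :: (nat + nat) set" and ?Y = "Inr ` {1..n} :: (nat + nat) set"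
  have per: "\<sigma> permutes {1..n}" "\<omega> permutes {1..n}" using assms by (auto simp: conj_class_def)
  have nf: "\<sigma> x \<noteq> x" "\<omega> x \<noteq> x" if "x \<in> {1..n}" for x
    using conj_class_no_fixpoint assms that by blast+
  have a: "bicoloured n ?P ?X ?Y" by (rule bicoloured_side_by_side[OF per])
  have p: "pure ?P ?X ?Y"
    using permutes_in_image[OF per(1)] permutes_in_image[OF per(2)]
    by (auto simp: pure_def side_by_side_def simp del: atLeastAtMost_iff)
  have f: "fixpts ?P ?Y = {}" "fixpts ?P (?X \<union> ?Y) = {}"
    using nf by (auto simp: fixpts_def side_by_side_def)
  have "?P x \<noteq> x" if "x \<in> ?X" for x using nf that by (auto simp: side_by_side_def)
  from mean_cycles_lower[OF a this] p f assms(1)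
  show "harm n - 3 + 6 * weight n \<le> mean_cycles ?P ?X ?Y"
    by (simp add: loss_def loss_const_def)
  show "mean_cycles ?P ?X ?Y \<le> harm n + 1"
    using mean_cycles_upper[OF a] p f pure_cross_once[OF a p] by (simp add: tame_def)
qed

theorem theorem3:
  fixes n :: nat and \<alpha> \<beta> :: "nat list"
  assumes "0 < n"
    and "partition_of n \<alpha>" and "1 \<notin> set \<alpha>"
    and "partition_of n \<beta>" and "1 \<notin> set \<beta>"
  shows "harm n - 3 < measure_pmf.expectation (cycle_count_pmf n \<alpha> \<beta>) real \<and>
         measure_pmf.expectation (cycle_count_pmf n \<alpha> \<beta>) real \<le> harm n + 1"
proof -
  let ?A = "conj_class n \<alpha>" and ?B = "conj_class n \<beta>"
  define N where "N = real (card ?A) * real (card ?B)"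
  define S where "S = (\<Sum>\<sigma>\<in>?A. \<Sum>\<omega>\<in>?B. real (card (cycles n (\<sigma> \<circ> \<omega>))))"
  have "0 < card ?A" "0 < card ?B"
    using assms by (simp_all add: card_gt_0_iff finite_conj_class conj_class_nonempty)
  then have N: "0 < N" by (simp add: N_def)
  have S: "S = (\<Sum>\<sigma>\<in>?A. \<Sum>\<omega>\<in>?B. mean_cycles (side_by_side \<sigma> \<omega>) (Inl ` {1..n}) (Inr ` {1..n}))"
    unfolding S_def by (intro sum.cong[OF refl] sum_cycles_conj_class) (auto simp: conj_class_def)
  have const: "N * c = (\<Sum>\<sigma>\<in>?A. \<Sum>\<omega>\<in>?B. c)" for c by (simp add: N_def)
  have "N * (harm n - 3 + 6 * weight n) \<le> S"
    unfolding const S using assms by (intro sum_mono mean_cycles_bounds(1)) auto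
  then have "harm n - 3 + 6 * weight n \<le> S / N" using N by (simp add: le_divide_eq mult.commute)
  moreover have "S \<le> N * (harm n + 1)"
    unfolding const S using assms by (intro sum_mono mean_cycles_bounds(2)) auto
  then have "S / N \<le> harm n + 1" using N by (simp add: divide_le_eq mult.commute)
  moreover have "measure_pmf.expectation (cycle_count_pmf n \<alpha> \<beta>) real = S / N"
    unfolding S_def N_def using assms by (intro expectation_cycle_count_pmf)
  ultimately show ?thesis using weight_pos[of n] by linarith
qed

end
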